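(* Let $(A,L,[\cdot,\cdot],\rho)$ be a Lie-Rinehart superalgebra over a field $\mathbb{K}$ of characteristic zero, and let $m=[\cdot,\cdot]\in\mathrm{Der}^1(L,L)$, with symbol map $\rho$. Then any non-trivial deformation of $m$ is equivalent to a deformation whose infinitesimal is not a coboundary (of the deformation complex).
   Context: $|x|\in\mathbb{Z}_2$ denotes the degree of a homogeneous element; identities are for homogeneous elements. A superderivation of $A$ of degree $|D|$ is a homogeneous linear map with $D(ab)=D(a)b+(-1)^{|a||D|}aD(b)$; $\mathrm{Der}(A)$ is the Lie superalgebra of superderivations with the supercommutator. A Lie-Rinehart superalgebra $(A,L,[\cdot,\cdot],\rho)$ over $\mathbb{K}$ consists of an associative supercommutative $\mathbb{K}$-superalgebra $A$, a Lie superalgebra $L$ over $\mathbb{K}$ (even bracket, $[x,y]=-(-1)^{|x||y|}[y,x]$, $[x,[y,z]]=[[x,y],z]+(-1)^{|x||y|}[y,[x,z]]$), an $A$-module structure on $L$ with $|ax|=|a|+|x|$, and an even Lie superalgebra morphism $\rho:L\to\mathrm{Der}(A)$ with $[x,ay]=\rho(x)(a)y+(-1)^{|a||x|}a[x,y]$ and $\rho(ax)(b)=a\rho(x)(b)$. For $n\ge 0$, $\mathrm{Der}^n(L,L)$ is the space of $\mathbb{K}$-multilinear maps $f:L^{\times(n+1)}\to L$ for which there exists a map $\sigma_f:L^{\otimes n}\to\mathrm{Der}(A)$ (symbol map) such that: (1) $f(x_1,\dots,x_i,x_{i+1},\dots,x_{n+1})=-(-1)^{|x_i||x_{i+1}|}f(x_1,\dots,x_{i+1},x_i,\dots,x_{n+1})$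 for $1\le i\le n$; (2) $f(x_1,\dots,x_n,ax_{n+1})=(-1)^{|a|(|f|+|x_1|+\cdots+|x_n|)}af(x_1,\dots,x_{n+1})+\sigma_f(x_1,\dots,x_n)(a)x_{n+1}$ for all $a\in A$. Here $|f|=j$ means $|f(x_1,\dots,x_{n+1})|-\sum_i|x_i|=j$ mod 2, and $\mathrm{Der}^n=\mathrm{Der}^n_0\oplus\mathrm{Der}^n_1$. For $f\in\mathrm{Der}^p(L,L)$, $g\in\mathrm{Der}^q(L,L)$, set \[(f\circ g)(x_1,\dots,x_{p+q+1})=\sum_{\tau}\varepsilon(\tau,x_1,\dots,x_{p+q+1})\,f\big(g(x_{\tau(1)},\dots,x_{\tau(q+1)}),x_{\tau(q+2)},\dots,x_{\tau(p+q+1)}\big),\] summing over permutations $\tau$ of $\{1,\dots,p+q+1\}$ with $\tau(1)<\cdots<\tau(q+1)$ and $\tau(q+2)<\cdots<\tau(p+q+1)$, where $\varepsilon$ is $\mathrm{sgn}(\tau)$ times the Koszul sign of the permutation of the homogeneous $x_i$. The bracket is $[f,g]=f\circ g-(-1)^{pq}g\circ f$. The deformation complex is $C^n_{def}(L,L)=\mathrm{Der}^{n-1}(L,L)$ with differential $\delta D=[m,D]$; a 2-coboundary is an element $\delta\phi$ with $\phi\in C^1_{def}(L,L)=\mathrm{Der}^0(L,L)$. A deformation of $m$ is a $\mathbb{K}[[t]]$-bilinear map $m_t=\sum_{i\ge0}t^im_i$ ($L\times L\to L[[t]]$, extended to $L[[t]]$ by $\mathbb{K}[[t]]$-bilinearity)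 with $m_0=m$, each $m_i\in\mathrm{Der}^1(L,L)$ even, and $[m_t,m_t]=0$, i.e. $m_t(x,m_t(y,z))=m_t(m_t(x,y),z)+(-1)^{|x||y|}m_t(y,m_t(x,z))$ for all homogeneous $x,y,z\in L$. The infinitesimal of the deformation is the first non-zero $m_i$ with $i\ge1$. Two deformations $m_t,m'_t$ of $m$ are equivalent if there is an even formal automorphism $\Phi_t=\mathrm{id}+\sum_{i\ge1}t^i\phi_i$ of $L[[t]]$, with $\phi_i:L\to L$ even $\mathbb{K}$-linear maps, such that $\Phi_t(m'_t(x,y))=m_t(\Phi_t(x),\Phi_t(y))$ for all $x,y\in L$. A deformation is trivial if it is equivalent to the deformation $m^0_t$ with $m^0_0=m$ and $m^0_i=0$ for $i\ge1$; otherwise it is non-trivial. *)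

theory Defs
  imports Complex_Main "HOL-Library.Z2" "HOL-Combinatorics.Permutations"
begin

section \<open>Super vector spaces\<close>

text \<open>Parities live in the two-element field \<^typ>\<open>bit\<close>, so that degrees add and the exponents
  in Koszul signs multiply as in \<open>\<int>\<^sub>2\<close>. A grading is the pair of subspaces \<open>G 0\<close>, \<open>G 1\<close>.\<close>

definition psign :: "bit \<Rightarrow> 'v::ab_group_add \<Rightarrow> 'v"
  where "psign d v = (if d = 0 then v else - v)" \<comment> \<open>\<open>(-1)^d v\<close>\<close>

locale super_vector_space = vector_space scale
  for scale :: "'k::field \<Rightarrow> 'v::ab_group_add \<Rightarrow> 'v" +
  fixes G :: "bit \<Rightarrow> 'v set"
  assumes subspace_grade: "module.subspace scale (G d)"
    and grade_inter: "G 0 \<inter> G 1 = {0}"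
    and grade_sum: "\<exists>v0\<in>G 0. \<exists>v1\<in>G 1. v = v0 + v1"

definition hcomp :: "(bit \<Rightarrow> 'v::ab_group_add set) \<Rightarrow> bit \<Rightarrow> 'v \<Rightarrow> 'v"
  where "hcomp G d v = (THE u. u \<in> G d \<and> v - u \<in> G (d + 1))"

definition homogeneous_list :: "(bit \<Rightarrow> 'v set) \<Rightarrow> bit list \<Rightarrow> 'v list \<Rightarrow> bool"
  where "homogeneous_list G ds xs \<longleftrightarrow> list_all2 (\<lambda>d x. x \<in> G d) ds xs"

definition multilinear ::
  "nat \<Rightarrow> ('k::field \<Rightarrow> 'v::ab_group_add \<Rightarrow> 'v) \<Rightarrow> ('k \<Rightarrow> 'w::ab_group_add \<Rightarrow> 'w) \<Rightarrow>
     ('v list \<Rightarrow> 'w) \<Rightarrow> bool"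
  where "multilinear n sV sW f \<longleftrightarrow>
    (\<forall>xs i. length xs = n \<longrightarrow> i < n \<longrightarrow> Vector_Spaces.linear sV sW (\<lambda>v. f (xs[i := v])))"


section \<open>Lie-Rinehart superalgebras\<close>

text \<open>Associativity and distributivity come from the class \<^class>\<open>ring\<close>; a unit is not required.\<close>

locale supercommutative_algebra = super_vector_space scale G
  for scale :: "'k::field \<Rightarrow> 'a::ring \<Rightarrow> 'a" and G :: "bit \<Rightarrow> 'a set" +
  assumes scale_mult_left: "scale c (a * b) = scale c a * b"
    and scale_mult_right: "scale c (a * b) = a * scale c b"
    and mult_grade: "a \<in> G d \<Longrightarrow> b \<in> G e \<Longrightarrow> a * b \<in> G (d + e)"
    and supercommute: "a \<in> G d \<Longrightarrow> b \<in> G e \<Longrightarrow> a * b = psign (d * e) (b * a)"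

locale lie_superalgebra = super_vector_space scale G
  for scale :: "'k::field \<Rightarrow> 'l::ab_group_add \<Rightarrow> 'l" and G :: "bit \<Rightarrow> 'l set" +
  fixes br :: "'l \<Rightarrow> 'l \<Rightarrow> 'l"
  assumes linear_left: "Vector_Spaces.linear scale scale (\<lambda>x. br x y)"
    and linear_right: "Vector_Spaces.linear scale scale (br x)"
    and br_grade: "x \<in> G d \<Longrightarrow> y \<in> G e \<Longrightarrow> br x y \<in> G (d + e)"
    and super_skew: "x \<in> G d \<Longrightarrow> y \<in> G e \<Longrightarrow> br x y = - psign (d * e) (br y x)"
    and super_jacobi: "x \<in> G d \<Longrightarrow> y \<in> G e \<Longrightarrow> z \<in> G f \<Longrightarrow>
      br x (br y z) = br (br x y) z + psign (d * e) (br y (br x z))"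

definition superderivations ::
  "('k::field \<Rightarrow> 'a::ring \<Rightarrow> 'a) \<Rightarrow> (bit \<Rightarrow> 'a set) \<Rightarrow> bit \<Rightarrow> ('a \<Rightarrow> 'a) set"
  where "superderivations scale G j = {D. Vector_Spaces.linear scale scale D \<and>
    (\<forall>d. \<forall>a\<in>G d. D a \<in> G (d + j)) \<and>
    (\<forall>d e. \<forall>a\<in>G d. \<forall>b\<in>G e. D (a * b) = D a * b + psign (d * j) (a * D b))}"

definition Der_alg :: "('k::field \<Rightarrow> 'a::ring \<Rightarrow> 'a) \<Rightarrow> (bit \<Rightarrow> 'a set) \<Rightarrow> ('a \<Rightarrow> 'a) set"
  where "Der_alg scale G =
    {\<lambda>a. D0 a + D1 a | D0 D1. D0 \<in> superderivations scale G 0 \<and> D1 \<in> superderivations scale G 1}"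

record ('k, 'a, 'l) lie_rinehart =
  scaleA :: "'k \<Rightarrow> 'a \<Rightarrow> 'a"
  gradeA :: "bit \<Rightarrow> 'a set"
  scaleL :: "'k \<Rightarrow> 'l \<Rightarrow> 'l"
  gradeL :: "bit \<Rightarrow> 'l set"
  bracketL :: "'l \<Rightarrow> 'l \<Rightarrow> 'l"
  act :: "'a \<Rightarrow> 'l \<Rightarrow> 'l"
  anchor :: "'l \<Rightarrow> 'a \<Rightarrow> 'a"

locale lie_rinehart_superalgebra =
  fixes S :: "('k::field, 'a::ring, 'l::ab_group_add) lie_rinehart" (structure)
  assumes algebra_A: "supercommutative_algebra (scaleA S) (gradeA S)"
    and lie_L: "lie_superalgebra (scaleL S) (gradeL S) (bracketL S)"
    and act_linear_left: "Vector_Spaces.linear (scaleA S) (scaleL S) (\<lambda>a. act S a x)"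
    and act_linear_right: "Vector_Spaces.linear (scaleL S) (scaleL S) (act S a)"
    and act_mult: "act S (a * b) x = act S a (act S b x)"
    and act_grade: "a \<in> gradeA S d \<Longrightarrow> x \<in> gradeL S e \<Longrightarrow> act S a x \<in> gradeL S (d + e)"
    and anchor_linear: "Vector_Spaces.linear (scaleL S) (scaleA S) (\<lambda>x. anchor S x a)"
    and anchor_grade:
      "x \<in> gradeL S d \<Longrightarrow> anchor S x \<in> superderivations (scaleA S) (gradeA S) d"
    and anchor_bracket: "x \<in> gradeL S d \<Longrightarrow> y \<in> gradeL S e \<Longrightarrow>
      anchor S (bracketL S x y) a =
        anchor S x (anchor S y a) - psign (d * e) (anchor S y (anchor S x a))"
    and leibniz: "x \<in> gradeL S d \<Longrightarrow> a \<in> gradeA S e \<Longrightarrow> y \<in> gradeL S f \<Longrightarrow>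
      bracketL S x (act S a y) =
        act S (anchor S x a) y + psign (e * d) (act S a (bracketL S x y))"
    and anchor_act: "a \<in> gradeA S d \<Longrightarrow> x \<in> gradeL S e \<Longrightarrow> b \<in> gradeA S f \<Longrightarrow>
      anchor S (act S a x) b = a * anchor S x b"


section \<open>The deformation complex\<close>

text \<open>A map \<open>L \<times> \<dots> \<times> L \<rightarrow> L\<close> in \<open>k\<close> arguments is a function on lists, constantly zero on lists
  of length other than \<open>k\<close>, so that equality of functions is equality of such maps.\<close>

definition is_symbol ::
  "('k::field, 'a::ring, 'l::ab_group_add) lie_rinehart \<Rightarrow> bit \<Rightarrow> nat \<Rightarrow>
     ('l list \<Rightarrow> 'l) \<Rightarrow> ('l list \<Rightarrow> 'a \<Rightarrow> 'a) \<Rightarrow> bool"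
  where "is_symbol S j n f \<sigma> \<longleftrightarrow>
    (\<forall>xs. length xs = n \<longrightarrow> \<sigma> xs \<in> Der_alg (scaleA S) (gradeA S)) \<and>
    (\<forall>a. multilinear n (scaleL S) (scaleA S) (\<lambda>xs. \<sigma> xs a)) \<and>
    (\<forall>ds xs d a e x. length xs = n \<longrightarrow> homogeneous_list (gradeL S) ds xs \<longrightarrow>
       a \<in> gradeA S d \<longrightarrow> x \<in> gradeL S e \<longrightarrow>
       f (xs @ [act S a x]) =
         psign (d * (j + sum_list ds)) (act S a (f (xs @ [x]))) + act S (\<sigma> xs a) x)"

definition Der_hom ::
  "('k::field, 'a::ring, 'l::ab_group_add) lie_rinehart \<Rightarrow> bit \<Rightarrow> nat \<Rightarrow> ('l list \<Rightarrow> 'l) set"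
  where "Der_hom S j n = {f.
    (\<forall>xs. length xs \<noteq> n + 1 \<longrightarrow> f xs = 0) \<and>
    multilinear (n + 1) (scaleL S) (scaleL S) f \<and>
    (\<forall>ds xs. length xs = n + 1 \<longrightarrow> homogeneous_list (gradeL S) ds xs \<longrightarrow>
       f xs \<in> gradeL S (j + sum_list ds)) \<and>
    (\<forall>ds xs i. length xs = n + 1 \<longrightarrow> homogeneous_list (gradeL S) ds xs \<longrightarrow> i < n \<longrightarrow>
       f xs = - psign (ds ! i * ds ! (i + 1)) (f (xs[i := xs ! (i + 1), i + 1 := xs ! i]))) \<and>
    (\<exists>\<sigma>. is_symbol S j n f \<sigma>)}"

definition Der ::
  "('k::field, 'a::ring, 'l::ab_group_add) lie_rinehart \<Rightarrow> nat \<Rightarrow> ('l list \<Rightarrow> 'l) set"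
  where "Der S n = {\<lambda>xs. f0 xs + f1 xs | f0 f1. f0 \<in> Der_hom S 0 n \<and> f1 \<in> Der_hom S 1 n}"

definition unshuffles :: "nat \<Rightarrow> nat \<Rightarrow> (nat \<Rightarrow> nat) set"
  where "unshuffles k N = {\<tau>. \<tau> permutes {..<N} \<and>
    strict_mono_on {..<k} \<tau> \<and> strict_mono_on {k..<N} \<tau>}"

definition koszul_exponent :: "(nat \<Rightarrow> nat) \<Rightarrow> bit list \<Rightarrow> bit"
  where "koszul_exponent \<tau> ds = (if evenperm \<tau> then 0 else 1) +
    (\<Sum>(i, j) | i < j \<and> j < length ds \<and> \<tau> j < \<tau> i. ds ! \<tau> i * ds ! \<tau> j)"

text \<open>The defining formula of \<open>f \<circ> g\<close> is for homogeneous arguments; it is extended multilinearly by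
  summing over the homogeneous components, of parities \<open>ds\<close>, of the arguments.\<close>

definition circ ::
  "('k::field, 'a::ring, 'l::ab_group_add) lie_rinehart \<Rightarrow> nat \<Rightarrow> nat \<Rightarrow>
     ('l list \<Rightarrow> 'l) \<Rightarrow> ('l list \<Rightarrow> 'l) \<Rightarrow> 'l list \<Rightarrow> 'l"
  where "circ S p q f g xs = (let N = p + q + 1 in
    if length xs \<noteq> N then 0
    else \<Sum>ds | length ds = N. \<Sum>\<tau>\<in>unshuffles (q + 1) N.
      (let ys = map2 (hcomp (gradeL S)) ds xs in
       psign (koszul_exponent \<tau> ds)
         (f (g (map (\<lambda>i. ys ! \<tau> i) [0..<q + 1]) # map (\<lambda>i. ys ! \<tau> i) [q + 1..<N]))))"

definition Der_bracket ::
  "('k::field, 'a::ring, 'l::ab_group_add) lie_rinehart \<Rightarrow> nat \<Rightarrow> nat \<Rightarrow>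
     ('l list \<Rightarrow> 'l) \<Rightarrow> ('l list \<Rightarrow> 'l) \<Rightarrow> 'l list \<Rightarrow> 'l"
  where "Der_bracket S p q f g xs = circ S p q f g xs - psign (of_nat (p * q)) (circ S q p g f xs)"

definition m_cochain ::
  "('k::field, 'a::ring, 'l::ab_group_add) lie_rinehart \<Rightarrow> 'l list \<Rightarrow> 'l"
  where "m_cochain S xs = (if length xs = 2 then bracketL S (xs ! 0) (xs ! 1) else 0)"

text \<open>The complex is considered only in degrees \<open>n \<ge> 1\<close>.\<close>

definition C_def ::
  "('k::field, 'a::ring, 'l::ab_group_add) lie_rinehart \<Rightarrow> nat \<Rightarrow> ('l list \<Rightarrow> 'l) set"
  where "C_def S n = Der S (n - 1)"

definition differential ::
  "('k::field, 'a::ring, 'l::ab_group_add) lie_rinehart \<Rightarrow> nat \<Rightarrow> ('l list \<Rightarrow> 'l) \<Rightarrow> 'l list \<Rightarrow> 'l"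
  where "differential S n D = Der_bracket S 1 (n - 1) (m_cochain S) D"

definition two_coboundary ::
  "('k::field, 'a::ring, 'l::ab_group_add) lie_rinehart \<Rightarrow> ('l list \<Rightarrow> 'l) \<Rightarrow> bool"
  where "two_coboundary S c \<longleftrightarrow> (\<exists>\<phi>\<in>C_def S 1. c = differential S 1 \<phi>)"


section \<open>Formal deformations\<close>

text \<open>An element of \<open>L[[t]]\<close> is its sequence of coefficients, of type \<^typ>\<open>nat \<Rightarrow> 'l\<close>.\<close>

definition series_const :: "'l::ab_group_add \<Rightarrow> nat \<Rightarrow> 'l"
  where "series_const x n = (if n = 0 then x else 0)"

definition series_apply :: "(nat \<Rightarrow> 'l \<Rightarrow> 'l::ab_group_add) \<Rightarrow> (nat \<Rightarrow> 'l) \<Rightarrow> nat \<Rightarrow> 'l"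
  where "series_apply \<Phi> X n = (\<Sum>i\<le>n. \<Phi> i (X (n - i)))"

definition series_apply2 ::
  "(nat \<Rightarrow> 'l list \<Rightarrow> 'l::ab_group_add) \<Rightarrow> (nat \<Rightarrow> 'l) \<Rightarrow> (nat \<Rightarrow> 'l) \<Rightarrow> nat \<Rightarrow> 'l"
  where "series_apply2 mt X Y n = (\<Sum>i\<le>n. \<Sum>j\<le>n - i. mt i [X j, Y (n - i - j)])"

definition deformation ::
  "('k::field, 'a::ring, 'l::ab_group_add) lie_rinehart \<Rightarrow> (nat \<Rightarrow> 'l list \<Rightarrow> 'l) \<Rightarrow> bool"
  where "deformation S mt \<longleftrightarrow>
    mt 0 = m_cochain S \<and>
    (\<forall>i. mt i \<in> Der_hom S 0 1) \<and>
    (\<forall>d e f. \<forall>x\<in>gradeL S d. \<forall>y\<in>gradeL S e. \<forall>z\<in>gradeL S f.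
      let X = series_const x; Y = series_const y; Z = series_const z in
      \<forall>n. series_apply2 mt X (series_apply2 mt Y Z) n =
        series_apply2 mt (series_apply2 mt X Y) Z n +
        psign (d * e) (series_apply2 mt Y (series_apply2 mt X Z) n))"

definition infinitesimal :: "(nat \<Rightarrow> 'l list \<Rightarrow> 'l::ab_group_add) \<Rightarrow> ('l list \<Rightarrow> 'l) \<Rightarrow> bool"
  where "infinitesimal mt c \<longleftrightarrow>
    (\<exists>i\<ge>1. c = mt i \<and> mt i \<noteq> (\<lambda>_. 0) \<and> (\<forall>j. 1 \<le> j \<and> j < i \<longrightarrow> mt j = (\<lambda>_. 0)))"

text \<open>\<open>\<Phi>\<close> is automatically bijective on \<open>L[[t]]\<close>, because its constant coefficient is the identity.\<close>

definition formal_automorphism ::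
  "('k::field, 'a::ring, 'l::ab_group_add) lie_rinehart \<Rightarrow> (nat \<Rightarrow> 'l \<Rightarrow> 'l) \<Rightarrow> bool"
  where "formal_automorphism S \<Phi> \<longleftrightarrow>
    \<Phi> 0 = id \<and>
    (\<forall>i. Vector_Spaces.linear (scaleL S) (scaleL S) (\<Phi> i)) \<and>
    (\<forall>i d. \<forall>x\<in>gradeL S d. \<Phi> i x \<in> gradeL S d)"

definition equivalent_deformations ::
  "('k::field, 'a::ring, 'l::ab_group_add) lie_rinehart \<Rightarrow>
     (nat \<Rightarrow> 'l list \<Rightarrow> 'l) \<Rightarrow> (nat \<Rightarrow> 'l list \<Rightarrow> 'l) \<Rightarrow> bool"
  where "equivalent_deformations S mt mt' \<longleftrightarrow>
    (\<exists>\<Phi>. formal_automorphism S \<Phi> \<and>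
      (\<forall>x y. series_apply \<Phi> (series_apply2 mt' (series_const x) (series_const y)) =
        series_apply2 mt (series_apply \<Phi> (series_const x)) (series_apply \<Phi> (series_const y))))"

definition constant_deformation ::
  "('k::field, 'a::ring, 'l::ab_group_add) lie_rinehart \<Rightarrow> nat \<Rightarrow> 'l list \<Rightarrow> 'l"
  where "constant_deformation S i = (if i = 0 then m_cochain S else (\<lambda>_. 0))"

definition trivial_deformation ::
  "('k::field, 'a::ring, 'l::ab_group_add) lie_rinehart \<Rightarrow> (nat \<Rightarrow> 'l list \<Rightarrow> 'l) \<Rightarrow> bool"
  where "trivial_deformation S mt \<longleftrightarrow> equivalent_deformations S mt (constant_deformation S)"

end

theory Submission
  imports Defs
begin

text \<open>Suppose every deformation equivalent to \<open>m\<^sub>t\<close> has a coboundary as its infinitesimal. If the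
  infinitesimal sits in degree \<open>N\<close>, it equals \<open>\<delta>\<psi>\<close> with \<open>\<psi>\<close> even, and conjugating by
  \<open>exp(- t\<^sup>N \<psi>)\<close> removes it without touching lower degrees; the infinite product of these
  automorphisms converges \<open>t\<close>-adically and trivialises \<open>m\<^sub>t\<close>. The exponential is needed instead of
  \<open>id - t\<^sup>N \<psi>\<close> so that the conjugate keeps its coefficients in \<open>Der\<^sup>1(L, L)\<close>: they are polynomials in
  the operator \<open>B \<mapsto> B(\<phi> x, y) + B(x, \<phi> y) - \<phi> B(x, y)\<close>, which preserves \<open>Der\<^sup>1(L, L)\<close> when \<open>\<phi>\<close> is a
  derivation of the module \<open>L\<close>.\<close>

section \<open>Formal power series with coefficients in a module\<close>

text \<open>For a module derivation \<open>\<psi>\<close> with symbol \<open>\<tau>\<close>, exp(t^N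
  \<open>\<psi>\<close>) is semilinear over exp(t^N \<open>\<tau>\<close>), an automorphism of
  A[[t]], so transport along it respects the Leibniz rule. The map id - t^N \<open>\<psi>\<close> is
  semilinear only to first order in t^N: from degree 2N on, the Leibniz rule of the conjugate
  bracket in general acquires stray terms such as multiples of \<open>\<psi> y\<close>. The price of
  the exponential is division by k!, hence characteristic zero. Two parity obstacles remain. A
  primitive of a coboundary may have an odd component, and so may the symbol of an even map, since
  \<open>L\<close> need not be a faithful \<open>A\<close>-module. Comparing degrees shows that
  neither contributes. The product converges because the factor introduced in degree N is the
  identity modulo t^N, so every coefficient is eventually frozen. Inverses of formal automorphisms
  are never formed: an equivalence is an intertwining equation, and injectivity suffices to pull the
  Jacobi identity back.\<close>

definition series_shift :: "(nat \<Rightarrow> 'l::ab_group_add) \<Rightarrow> nat \<Rightarrow> 'l"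
  where "series_shift X n = (case n of 0 \<Rightarrow> 0 | Suc k \<Rightarrow> X k)"

lemma series_shift_simps [simp]:
  "series_shift X 0 = 0" "series_shift X (Suc n) = X n"
  by (simp_all add: series_shift_def)

text \<open>Additivity together with commutation with \<open>t\<close>, since
  \<open>series_shift\<close> is multiplication by \<open>t\<close>. Maps of this kind are closed
  under composition, sums and signs, so both sides of the intertwining and Jacobi identities qualify
  in each argument separately.\<close>

definition series_linear :: "((nat \<Rightarrow> 'l::ab_group_add) \<Rightarrow> nat \<Rightarrow> 'l) \<Rightarrow> bool"
  where "series_linear T \<longleftrightarrow> (\<forall>X Y. T (\<lambda>n. X n + Y n) = (\<lambda>n. T X n + T Y n)) \<and>
    (\<forall>X. T (series_shift X) = series_shift (T X))"

lemma series_decomp: "X = (\<lambda>n. series_const (X 0) n + series_shift (\<lambda>n. X (Suc n)) n)"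
proof
  fix n show "X n = series_const (X 0) n + series_shift (\<lambda>n. X (Suc n)) n"
    by (cases n) (auto simp: series_const_def)
qed

text \<open>Commuting with multiplication by \<open>t\<close> already forces \<open>t\<close>-adic continuity, so such maps are
  determined by their values on constant series.\<close>

lemma series_linear_eqI:
  assumes T: "series_linear T" and U: "series_linear U"
    and const: "\<And>x. x \<in> V \<Longrightarrow> T (series_const x) = U (series_const x)"
    and X: "\<And>n. X n \<in> V"
  shows "T X = U X"
proof
  \<comment> \<open>Writing \<open>X\<close> as its constant term plus \<open>t\<close> times its
    tail, coefficient \<open>n\<close> of \<open>F X\<close> depends only on \<open>F\<close> of a
    constant and on coefficient \<open>n - 1\<close> of \<open>F\<close> of the tail; hence the
    induction on \<open>n\<close> with \<open>X\<close> generalised.\<close>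
  have split: "F X n = F (series_const (X 0)) n + series_shift (F (\<lambda>n. X (Suc n))) n"
    if "series_linear F" for F :: "(nat \<Rightarrow> 'a) \<Rightarrow> nat \<Rightarrow> 'a" and X n
  proof -
    have "F X = F (\<lambda>n. series_const (X 0) n + series_shift (\<lambda>n. X (Suc n)) n)"
      using series_decomp[of X] by (rule arg_cong)
    also have "\<dots> = (\<lambda>n. F (series_const (X 0)) n + F (series_shift (\<lambda>n. X (Suc n))) n)"
      using that unfolding series_linear_def by blast
    also have "F (series_shift (\<lambda>n. X (Suc n))) = series_shift (F (\<lambda>n. X (Suc n)))"
      using that unfolding series_linear_def by blast
    finally show ?thesis by (rule fun_cong)
  qed
  fix n
  show "T X n = U X n" using X
  proof (induction n arbitrary: X)
    case (0 X)
    then show ?case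
      unfolding split[OF T, of X] split[OF U, of X] by (simp add: const)
  next
    case (Suc n X)
    then show ?case
      unfolding split[OF T, of X] split[OF U, of X] by (simp add: const)
  qed
qed

lemma series_linear_compose:
  "series_linear T \<Longrightarrow> series_linear U \<Longrightarrow> series_linear (\<lambda>X. T (U X))"
  by (simp add: series_linear_def)

lemma series_linear_add:
  assumes "series_linear T" "series_linear U"
  shows "series_linear (\<lambda>X n. T X n + U X n)"
proof -
  have "T (\<lambda>n. X n + Y n) = (\<lambda>n. T X n + T Y n)" "U (\<lambda>n. X n + Y n) = (\<lambda>n. U X n + U Y n)"
    "T (series_shift X) = series_shift (T X)" "U (series_shift X) = series_shift (U X)" for X Y
    using assms unfolding series_linear_def by blast+
  then show ?thesis
    unfolding series_linear_def
    by (simp only:) (auto simp: fun_eq_iff series_shift_def algebra_simps split: nat.split)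
qed

lemma series_linear_psign:
  assumes "series_linear T"
  shows "series_linear (\<lambda>X n. psign d (T X n))"
proof -
  have "T (\<lambda>n. X n + Y n) = (\<lambda>n. T X n + T Y n)" "T (series_shift X) = series_shift (T X)" for X Y
    using assms unfolding series_linear_def by blast+
  then show ?thesis
    unfolding series_linear_def
    by (simp only:) (auto simp: fun_eq_iff series_shift_def psign_def split: nat.split)
qed

lemma sum_shift_right:
  "(\<Sum>i\<le>n. series_shift (G i) (n - i)) = series_shift (\<lambda>n. \<Sum>i\<le>n. G i (n - i)) n"
  by (cases n) (auto simp: Suc_diff_le)

lemma sum_shift_left:
  assumes "\<And>k. f 0 k = 0"
  shows "(\<Sum>i\<le>n. f (series_shift X i) (n - i)) = series_shift (\<lambda>n. \<Sum>i\<le>n. f (X i) (n - i)) n"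
  by (cases n) (auto simp: assms sum.atMost_Suc_shift simp del: sum.atMost_Suc)

definition biadditive :: "('l list \<Rightarrow> 'l::ab_group_add) \<Rightarrow> bool"
  where "biadditive f \<longleftrightarrow>
    (\<forall>x x' y. f [x + x', y] = f [x, y] + f [x', y]) \<and> (\<forall>x y y'. f [x, y + y'] = f [x, y] + f [x, y'])"

lemma biadditive_zero:
  assumes "biadditive f" shows "f [0, y] = 0" "f [x, 0] = 0"
proof -
  have "f [0 + 0, y] = f [0, y] + f [0, y]" "f [x, 0 + 0] = f [x, 0] + f [x, 0]"
    using assms unfolding biadditive_def by blast+
  then show "f [0, y] = 0" "f [x, 0] = 0" by simp_all
qed

lemma series_linear_apply:
  assumes add: "\<And>i x y. \<Phi> i (x + y) = \<Phi> i x + \<Phi> i y"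
  shows "series_linear (series_apply \<Phi>)"
proof -
  have zero: "\<Phi> i 0 = 0" for i
    using add[of i 0 0] by simp
  have "\<Phi> i (series_shift X k) = series_shift (\<lambda>k. \<Phi> i (X k)) k" for i X k
    by (cases k) (simp_all add: zero)
  then show ?thesis
    by (auto simp: series_linear_def series_apply_def[abs_def] fun_eq_iff add sum.distrib
        sum_shift_right)
qed

lemma series_linear_apply2_right:
  assumes "\<And>i. biadditive (m i)"
  shows "series_linear (series_apply2 m X)"
proof -
  have "m i [x, series_shift Y k] = series_shift (\<lambda>k. m i [x, Y k]) k" for i x Y k
    by (cases k) (simp_all add: biadditive_zero[OF assms])
  then show ?thesis
    using assms
    by (auto simp: series_linear_def series_apply2_def[abs_def] fun_eq_iff sum.distrib
        sum_shift_right biadditive_def simp del: diff_diff_left)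
qed

lemma series_linear_apply2_left:
  assumes "\<And>i. biadditive (m i)"
  shows "series_linear (\<lambda>X. series_apply2 m X Y)"
proof -
  have "(\<Sum>j\<le>k. m i [series_shift X j, Y (k - j)]) = series_shift (\<lambda>k. \<Sum>j\<le>k. m i [X j, Y (k - j)]) k"
    for i X k
    by (rule sum_shift_left[where f = "\<lambda>x k. m i [x, Y k]"]) (simp add: biadditive_zero[OF assms])
  then show ?thesis
    using assms
    by (auto simp: series_linear_def series_apply2_def[abs_def] fun_eq_iff sum.distrib
        sum_shift_right biadditive_def simp del: diff_diff_left)
qed

lemma series_apply_const:
  assumes "\<And>i. \<Phi> i 0 = 0"
  shows "series_apply \<Phi> (series_const x) n = \<Phi> n x"
proof -
  have "series_apply \<Phi> (series_const x) n = (\<Sum>i\<le>n. if i = n then \<Phi> n x else 0)"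
    unfolding series_apply_def
    by (rule sum.cong) (auto simp: series_const_def assms)
  then show ?thesis by simp
qed

text \<open>Coefficient \<open>n\<close> of the image is \<open>X n\<close> plus terms in earlier
  coefficients, so the system is unitriangular. This takes the place of an inverse of
  \<open>\<Phi>\<close>.\<close>

lemma series_apply_inj:
  assumes id: "\<Phi> 0 = id" and eq: "series_apply \<Phi> X = series_apply \<Phi> Y"
  shows "X = Y"
proof
  fix n show "X n = Y n"
  proof (induction n rule: less_induct)
    case (less n)
    have split: "series_apply \<Phi> X n = X n + (\<Sum>i<n. \<Phi> (Suc i) (X (n - Suc i)))" for X
      unfolding series_apply_def by (subst sum.atMost_shift) (simp add: id)
    have "(\<Sum>i<n. \<Phi> (Suc i) (X (n - Suc i))) = (\<Sum>i<n. \<Phi> (Suc i) (Y (n - Suc i)))"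
      by (rule sum.cong) (auto simp: less)
    then show ?case
      using fun_cong[OF eq, of n] by (simp add: split)
  qed
qed

section \<open>Composition of formal operators, and identities extended from constants to
  series\<close>

definition series_compose ::
  "(nat \<Rightarrow> 'l \<Rightarrow> 'l) \<Rightarrow> (nat \<Rightarrow> 'l \<Rightarrow> 'l) \<Rightarrow> nat \<Rightarrow> 'l \<Rightarrow> 'l::ab_group_add"
  where "series_compose \<Phi> \<Psi> n x = series_apply \<Phi> (\<lambda>i. \<Psi> i x) n"

lemma series_apply_compose:
  assumes \<Phi>: "\<And>i x y. \<Phi> i (x + y) = \<Phi> i x + \<Phi> i y" and \<Psi>: "\<And>i x y. \<Psi> i (x + y) = \<Psi> i x + \<Psi> i y"
  shows "series_apply (series_compose \<Phi> \<Psi>) X = series_apply \<Phi> (series_apply \<Psi> X)"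
proof (rule series_linear_eqI[where V = UNIV and X = X and
      T = "series_apply (series_compose \<Phi> \<Psi>)" and U = "\<lambda>X. series_apply \<Phi> (series_apply \<Psi> X)"])
  have zero: "\<Phi> i 0 = 0" "\<Psi> i 0 = 0" for i
    using \<Phi>[of i 0 0] \<Psi>[of i 0 0] by simp_all
  show "series_linear (series_apply (series_compose \<Phi> \<Psi>))"
    by (rule series_linear_apply)
      (simp only: series_compose_def series_apply_def \<Phi> \<Psi> sum.distrib)
  show "series_linear (\<lambda>X. series_apply \<Phi> (series_apply \<Psi> X))"
    by (rule series_linear_compose[OF series_linear_apply[of \<Phi>, OF \<Phi>] series_linear_apply[of \<Psi>, OF \<Psi>]])
  fix x
  have *: "series_apply \<Psi> (series_const x) = (\<lambda>i. \<Psi> i x)"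
    by (rule ext) (rule series_apply_const, rule zero)
  show "series_apply (series_compose \<Phi> \<Psi>) (series_const x) =
      series_apply \<Phi> (series_apply \<Psi> (series_const x))"
  proof
    fix n
    have "series_apply (series_compose \<Phi> \<Psi>) (series_const x) n = series_compose \<Phi> \<Psi> n x"
      by (rule series_apply_const) (simp add: series_compose_def series_apply_def zero)
    then show "series_apply (series_compose \<Phi> \<Psi>) (series_const x) n =
        series_apply \<Phi> (series_apply \<Psi> (series_const x)) n"
      unfolding * series_compose_def .
  qed
qed (rule UNIV_I)

text \<open>An equivalence is prescribed on constant series only, but composing two of them, or
  applying one to a nested bracket, requires it on all of L[[t]]. The extension is made one argument
  at a time.\<close>

lemma intertwines_series:
  assumes \<Phi>: "\<And>i x y. \<Phi> i (x + y) = \<Phi> i x + \<Phi> i y"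
    and m: "\<And>i. biadditive (m i)" and m': "\<And>i. biadditive (m' i)"
    and const: "\<And>x y. series_apply \<Phi> (series_apply2 m' (series_const x) (series_const y)) =
      series_apply2 m (series_apply \<Phi> (series_const x)) (series_apply \<Phi> (series_const y))"
  shows "series_apply \<Phi> (series_apply2 m' X Y) = series_apply2 m (series_apply \<Phi> X) (series_apply \<Phi> Y)"
proof -
  note lin = series_linear_apply[of \<Phi>, OF \<Phi>]
  note r = series_linear_apply2_right[of m, OF m] series_linear_apply2_right[of m', OF m']
  note l = series_linear_apply2_left[of m, OF m] series_linear_apply2_left[of m', OF m']
  have 1: "series_apply \<Phi> (series_apply2 m' (series_const x) Y) =
      series_apply2 m (series_apply \<Phi> (series_const x)) (series_apply \<Phi> Y)" for x
  proof (rule series_linear_eqI[where V = UNIV and X = Y and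
        T = "\<lambda>Y. series_apply \<Phi> (series_apply2 m' (series_const x) Y)" and
        U = "\<lambda>Y. series_apply2 m (series_apply \<Phi> (series_const x)) (series_apply \<Phi> Y)"])
    show "series_linear (\<lambda>Y. series_apply \<Phi> (series_apply2 m' (series_const x) Y))"
      by (rule series_linear_compose[OF lin r(2)])
    show "series_linear (\<lambda>Y. series_apply2 m (series_apply \<Phi> (series_const x)) (series_apply \<Phi> Y))"
      by (rule series_linear_compose[OF r(1) lin])
  qed (rule const, rule UNIV_I)
  show ?thesis
  proof (rule series_linear_eqI[where V = UNIV and X = X and
        T = "\<lambda>X. series_apply \<Phi> (series_apply2 m' X Y)" and
        U = "\<lambda>X. series_apply2 m (series_apply \<Phi> X) (series_apply \<Phi> Y)"])
    show "series_linear (\<lambda>X. series_apply \<Phi> (series_apply2 m' X Y))"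
      by (rule series_linear_compose[OF lin l(2)])
    show "series_linear (\<lambda>X. series_apply2 m (series_apply \<Phi> X) (series_apply \<Phi> Y))"
      by (rule series_linear_compose[OF l(1) lin])
  qed (rule 1, rule UNIV_I)
qed

text \<open>The sets \<open>V\<close>, \<open>W\<close>, \<open>U\<close> will be homogeneous
  components: a formal automorphism turns constants into series all of whose coefficients have one
  degree, so the sign \<open>s\<close> stays the same in every coefficient. The identity is extended
  in the third argument, then the second, then the first.\<close>

lemma jacobi_series:
  assumes m: "\<And>i. biadditive (m i)"
    and const: "\<And>x y z. x \<in> V \<Longrightarrow> y \<in> W \<Longrightarrow> z \<in> U \<Longrightarrow>
      series_apply2 m (series_const x) (series_apply2 m (series_const y) (series_const z)) =
      (\<lambda>n. series_apply2 m (series_apply2 m (series_const x) (series_const y)) (series_const z) n +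
        psign s (series_apply2 m (series_const y) (series_apply2 m (series_const x) (series_const z)) n))"
    and X: "\<And>n. X n \<in> V" and Y: "\<And>n. Y n \<in> W" and Z: "\<And>n. Z n \<in> U"
  shows "series_apply2 m X (series_apply2 m Y Z) =
    (\<lambda>n. series_apply2 m (series_apply2 m X Y) Z n + psign s (series_apply2 m Y (series_apply2 m X Z) n))"
proof -
  note r = series_linear_apply2_right[of m, OF m] and l = series_linear_apply2_left[of m, OF m]
  have rr: "series_linear (\<lambda>X. series_apply2 m A (series_apply2 m B X))" for A B
    by (rule series_linear_compose[OF r r])
  have rl: "series_linear (\<lambda>X. series_apply2 m A (series_apply2 m X B))" for A B
    by (rule series_linear_compose[OF r l])
  have lr: "series_linear (\<lambda>X. series_apply2 m (series_apply2 m A X) B)" for A B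
    by (rule series_linear_compose[OF l r])
  have ll: "series_linear (\<lambda>X. series_apply2 m (series_apply2 m X A) B)" for A B
    by (rule series_linear_compose[OF l l])
  have 1: "series_apply2 m (series_const x) (series_apply2 m (series_const y) Z) = (\<lambda>n. series_apply2 m (series_apply2 m (series_const x) (series_const y)) Z n +
        psign s (series_apply2 m (series_const y) (series_apply2 m (series_const x) Z) n))"
    if x: "x \<in> V" and y: "y \<in> W" for x y
  proof (rule series_linear_eqI[where V = U and X = Z and T = "\<lambda>Z. series_apply2 m (series_const x) (series_apply2 m (series_const y) Z)" and
        U = "\<lambda>Z n. series_apply2 m (series_apply2 m (series_const x) (series_const y)) Z n +
        psign s (series_apply2 m (series_const y) (series_apply2 m (series_const x) Z) n)"])
    show "series_linear (\<lambda>Z. series_apply2 m (series_const x) (series_apply2 m (series_const y) Z))"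
      by (rule rr)
    show "series_linear (\<lambda>Z n. series_apply2 m (series_apply2 m (series_const x) (series_const y)) Z n +
        psign s (series_apply2 m (series_const y) (series_apply2 m (series_const x) Z) n))"
      by (rule series_linear_add[OF r series_linear_psign[OF rr]])
  qed (rule const[OF x y], assumption, rule Z)
  have 2: "series_apply2 m (series_const x) (series_apply2 m Y Z) = (\<lambda>n. series_apply2 m (series_apply2 m (series_const x) Y) Z n +
        psign s (series_apply2 m Y (series_apply2 m (series_const x) Z) n))"
    if x: "x \<in> V" for x
  proof (rule series_linear_eqI[where V = W and X = Y and T = "\<lambda>Y. series_apply2 m (series_const x) (series_apply2 m Y Z)" and
        U = "\<lambda>Y n. series_apply2 m (series_apply2 m (series_const x) Y) Z n +
        psign s (series_apply2 m Y (series_apply2 m (series_const x) Z) n)"])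
    show "series_linear (\<lambda>Y. series_apply2 m (series_const x) (series_apply2 m Y Z))"
      by (rule rl)
    show "series_linear (\<lambda>Y n. series_apply2 m (series_apply2 m (series_const x) Y) Z n +
        psign s (series_apply2 m Y (series_apply2 m (series_const x) Z) n))"
      by (rule series_linear_add[OF lr series_linear_psign[OF l]])
  qed (rule 1[OF x], assumption, rule Y)
  show ?thesis
  proof (rule series_linear_eqI[where V = V and X = X and T = "\<lambda>X. series_apply2 m X (series_apply2 m Y Z)" and
        U = "\<lambda>X n. series_apply2 m (series_apply2 m X Y) Z n +
        psign s (series_apply2 m Y (series_apply2 m X Z) n)"])
    show "series_linear (\<lambda>X. series_apply2 m X (series_apply2 m Y Z))"
      by (rule l)
    show "series_linear (\<lambda>X n. series_apply2 m (series_apply2 m X Y) Z n +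
        psign s (series_apply2 m Y (series_apply2 m X Z) n))"
      by (rule series_linear_add[OF ll series_linear_psign[OF rl]])
  qed (rule 2, assumption, rule X)
qed

section \<open>Exponentials\<close>

text \<open>The derivative at s = 0 of exp(-s \<open>\<phi>\<close>) B(exp(s \<open>\<phi>\<close>)
  x, exp(s \<open>\<phi>\<close>) y), which is minus the Lie derivative of \<open>B\<close> along
  \<open>\<phi>\<close>. For the bracket and an even \<open>\<phi>\<close> it is the coboundary of
  \<open>\<phi>\<close>.\<close>

definition derive_bilinear :: "('l::ab_group_add \<Rightarrow> 'l) \<Rightarrow> ('l \<Rightarrow> 'l \<Rightarrow> 'l) \<Rightarrow> 'l \<Rightarrow> 'l \<Rightarrow> 'l"
  where "derive_bilinear \<phi> B x y = B (\<phi> x) y + B x (\<phi> y) - \<phi> (B x y)"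

lemma sum_triangle:
  "(\<Sum>i\<le>n. \<Sum>j\<le>n - i. g i j) = (\<Sum>k\<le>n. \<Sum>i\<le>k. g i (k - i))" for n :: nat
proof -
  have "(\<Sum>i\<le>n. \<Sum>j\<le>n - i. g i j) = (\<Sum>(i, j)\<in>(SIGMA i:{..n}. {..n - i}). g i j)"
    by (simp add: sum.Sigma)
  also have "(SIGMA i:{..n}. {..n - i}) = {(i, j). i + j \<le> n}"
    by auto
  finally show ?thesis by (simp add: sum.triangle_reindex_eq)
qed

text \<open>Turns a Cauchy product of series in t^N into one in the single variable t^N.\<close>

lemma sum_multiples:
  fixes N :: nat
  assumes "N \<ge> 1" and "\<And>i. i \<le> N * k \<Longrightarrow> \<not> N dvd i \<Longrightarrow> h i = 0"
  shows "(\<Sum>i\<le>N * k. h i) = (\<Sum>a\<le>k. h (N * a))"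
proof -
  have "(\<Sum>a\<le>k. h (N * a)) = (\<Sum>i\<in>(*) N ` {..k}. h i)"
    using assms(1) by (subst sum.reindex) (auto simp: inj_on_def)
  also have "\<dots> = (\<Sum>i\<le>N * k. h i)"
  proof (intro sum.mono_neutral_left ballI)
    fix i assume i: "i \<in> {..N * k} - (*) N ` {..k}"
    have "\<not> N dvd i"
    proof
      assume "N dvd i"
      then obtain a where "i = N * a" by (elim dvdE)
      with i assms(1) show False by auto
    qed
    with i assms(2) show "h i = 0" by simp
  qed auto
  finally show ?thesis by simp
qed

locale char_0_vector_space = vector_space scale
  for scale :: "'k::field_char_0 \<Rightarrow> 'v::ab_group_add \<Rightarrow> 'v"
begin

abbreviation lin :: "('v \<Rightarrow> 'v) \<Rightarrow> bool"
  where "lin \<equiv> Vector_Spaces.linear scale scale"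

definition bilin :: "('v \<Rightarrow> 'v \<Rightarrow> 'v) \<Rightarrow> bool"
  where "bilin B \<longleftrightarrow> (\<forall>x. lin (B x)) \<and> (\<forall>y. lin (\<lambda>x. B x y))"

lemma lin_iff: "lin f \<longleftrightarrow> (\<forall>x y. f (x + y) = f x + f y) \<and> (\<forall>c x. f (scale c x) = scale c (f x))"
  by (simp add: Vector_Spaces.linear_iff vector_space_axioms)

lemma lin_simps:
  assumes "lin f"
  shows "f (x + y) = f x + f y" "f (scale c x) = scale c (f x)" "f 0 = 0" "f (- x) = - f x"
    "f (x - y) = f x - f y" "f (sum g A) = (\<Sum>a\<in>A. f (g a))" "f (psign d x) = psign d (f x)"
proof -
  interpret Vector_Spaces.linear scale scale f by fact
  show "f (x + y) = f x + f y" "f (scale c x) = scale c (f x)" "f 0 = 0" "f (- x) = - f x"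
    "f (x - y) = f x - f y" "f (sum g A) = (\<Sum>a\<in>A. f (g a))" "f (psign d x) = psign d (f x)"
    by (simp_all add: add scale neg diff sum psign_def)
qed

lemma bilin_simps:
  assumes "bilin B"
  shows "B (x + y) z = B x z + B y z" "B (scale c x) z = scale c (B x z)" "B 0 z = 0"
    "B (- x) z = - B x z" "B (x - y) z = B x z - B y z" "B (sum g A) z = (\<Sum>a\<in>A. B (g a) z)"
    "B (psign d x) z = psign d (B x z)"
    "B z (x + y) = B z x + B z y" "B z (scale c x) = scale c (B z x)" "B z 0 = 0"
    "B z (- x) = - B z x" "B z (x - y) = B z x - B z y" "B z (sum g A) = (\<Sum>a\<in>A. B z (g a))"
    "B z (psign d x) = psign d (B z x)"
proof -
  have l: "lin (\<lambda>x. B x z)" and r: "lin (B z)" using assms by (auto simp: bilin_def)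
  show "B (x + y) z = B x z + B y z" "B (scale c x) z = scale c (B x z)" "B 0 z = 0"
    "B (- x) z = - B x z" "B (x - y) z = B x z - B y z" "B (sum g A) z = (\<Sum>a\<in>A. B (g a) z)"
    "B (psign d x) z = psign d (B x z)"
    using lin_simps[OF l] .
  show "B z (x + y) = B z x + B z y" "B z (scale c x) = scale c (B z x)" "B z 0 = 0"
    "B z (- x) = - B z x" "B z (x - y) = B z x - B z y" "B z (sum g A) = (\<Sum>a\<in>A. B z (g a))"
    "B z (psign d x) = psign d (B z x)"
    using lin_simps[OF r] .
qed

lemma bilin_derive:
  assumes "lin \<phi>" "bilin B" shows "bilin (derive_bilinear \<phi> B)"
  unfolding bilin_def lin_iff derive_bilinear_def
  by (auto simp: lin_simps[OF assms(1)] bilin_simps[OF assms(2)] scale_right_diff_distrib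
      scale_right_distrib)

definition divpow :: "nat \<Rightarrow> ('v \<Rightarrow> 'v) \<Rightarrow> 'v \<Rightarrow> 'v"
  where "divpow k \<phi> x = scale (1 / fact k) ((\<phi> ^^ k) x)"

definition derive_divpow :: "nat \<Rightarrow> ('v \<Rightarrow> 'v) \<Rightarrow> ('v \<Rightarrow> 'v \<Rightarrow> 'v) \<Rightarrow> 'v \<Rightarrow> 'v \<Rightarrow> 'v"
  where "derive_divpow k \<phi> B x y = scale (1 / fact k) ((derive_bilinear \<phi> ^^ k) B x y)"

lemma lin_divpow:
  assumes "lin \<phi>" shows "lin (divpow k \<phi>)"
proof -
  have "lin (\<phi> ^^ k)"
    by (induction k) (auto simp: lin_iff lin_simps[OF assms])
  then show ?thesis
    unfolding lin_iff divpow_def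
    by (simp add: scale_right_distrib mult.commute)
qed

lemma divpow_0 [simp]: "divpow 0 \<phi> x = x" "derive_divpow 0 \<phi> B x y = B x y"
  by (simp_all add: divpow_def derive_divpow_def)

text \<open>Coefficient form of the differential equation of the exponential, kept free of division
  so that it can be applied under a sum. The new factor is split off on the inside or on the
  outside; in the third form it replaces \<open>B\<close> by its derivative.\<close>

lemma divpow_Suc:
  shows "scale (of_nat (Suc k)) (divpow (Suc k) \<phi> x) = divpow k \<phi> (\<phi> x)"
    and "lin \<phi> \<Longrightarrow> scale (of_nat (Suc k)) (divpow (Suc k) \<phi> x) = \<phi> (divpow k \<phi> x)"
    and "scale (of_nat (Suc k)) (derive_divpow (Suc k) \<phi> B x y) = derive_divpow k \<phi> (derive_bilinear \<phi> B) x y"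
proof -
  have "of_nat (Suc k) * (1 / fact (Suc k)) = (1 / fact k :: 'k)"
    by (simp add: field_simps del: of_nat_Suc)
  then show "scale (of_nat (Suc k)) (divpow (Suc k) \<phi> x) = divpow k \<phi> (\<phi> x)"
    and "lin \<phi> \<Longrightarrow> scale (of_nat (Suc k)) (divpow (Suc k) \<phi> x) = \<phi> (divpow k \<phi> x)"
    and "scale (of_nat (Suc k)) (derive_divpow (Suc k) \<phi> B x y) = derive_divpow k \<phi> (derive_bilinear \<phi> B) x y"
    unfolding divpow_def derive_divpow_def
    by (simp_all only: scale_scale lin_simps(2)) (simp_all only: funpow_swap1 funpow.simps o_apply)
qed

text \<open>The product rule (f g)' = f' g + f g' for power series: the weight \<open>Suc k\<close>
  splits as \<open>a\<close> plus \<open>Suc k - a\<close>, and in each half the term of weight zero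
  drops out.\<close>

lemma scale_sum_antidiagonal:
  "scale (of_nat (Suc k)) (\<Sum>a\<le>Suc k. h a (Suc k - a)) =
    (\<Sum>a\<le>k. scale (of_nat (Suc a)) (h (Suc a) (k - a))) +
    (\<Sum>a\<le>k. scale (of_nat (Suc (k - a))) (h a (Suc (k - a))))"
proof -
  have "scale (of_nat (Suc k)) (\<Sum>a\<le>Suc k. h a (Suc k - a)) =
      (\<Sum>a\<le>Suc k. scale (of_nat a) (h a (Suc k - a)) + scale (of_nat (Suc k - a)) (h a (Suc k - a)))"
    unfolding scale_sum_right
    by (rule sum.cong) (simp_all only: scale_left_distrib[symmetric] of_nat_add[symmetric] atMost_iff le_add_diff_inverse)
  also have "\<dots> = (\<Sum>a\<le>Suc k. scale (of_nat a) (h a (Suc k - a))) +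
      (\<Sum>a\<le>Suc k. scale (of_nat (Suc k - a)) (h a (Suc k - a)))"
    by (rule sum.distrib)
  also have "(\<Sum>a\<le>Suc k. scale (of_nat a) (h a (Suc k - a))) =
      (\<Sum>a\<le>k. scale (of_nat (Suc a)) (h (Suc a) (k - a)))"
    unfolding sum.atMost_Suc_shift by (simp del: of_nat_Suc)
  also have "(\<Sum>a\<le>Suc k. scale (of_nat (Suc k - a)) (h a (Suc k - a))) =
      (\<Sum>a\<le>k. scale (of_nat (Suc (k - a))) (h a (Suc (k - a))))"
    unfolding sum.atMost_Suc by (simp add: Suc_diff_le del: of_nat_Suc)
  finally show ?thesis .
qed

text \<open>This is \<open>e\<^sup>\<phi> ((e\<^sup>D B)(x, y)) = B(e\<^sup>\<phi> x, e\<^sup>\<phi> y)\<close> in degree \<open>k\<close>, with \<open>D = derive_bilinear \<phi>\<close>: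
  both sides satisfy the same first-order recursion in \<open>k\<close>.\<close>

lemma divpow_intertwines:
  assumes \<phi>: "lin \<phi>" and B: "bilin B"
  shows "(\<Sum>a\<le>k. divpow a \<phi> (derive_divpow (k - a) \<phi> B x y)) =
    (\<Sum>a\<le>k. B (divpow a \<phi> x) (divpow (k - a) \<phi> y))"
  using B
\<comment> \<open>\<open>B\<close> is generalised because the recursion replaces it by
  \<open>derive_bilinear \<phi> B\<close>.\<close>
proof (induction k arbitrary: B)
  case 0
  then show ?case by simp
next
  case (Suc k B)
  let ?c = "of_nat (Suc k) :: 'k" and ?D = "derive_bilinear \<phi> B"
  note B = bilin_simps[OF Suc.prems]
  have "scale ?c (\<Sum>a\<le>Suc k. divpow a \<phi> (derive_divpow (Suc k - a) \<phi> B x y)) =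
      (\<Sum>a\<le>k. scale (of_nat (Suc a)) (divpow (Suc a) \<phi> (derive_divpow (k - a) \<phi> B x y))) +
      (\<Sum>a\<le>k. scale (of_nat (Suc (k - a))) (divpow a \<phi> (derive_divpow (Suc (k - a)) \<phi> B x y)))"
    by (rule scale_sum_antidiagonal)
  also have "\<dots> = \<phi> (\<Sum>a\<le>k. divpow a \<phi> (derive_divpow (k - a) \<phi> B x y)) +
      (\<Sum>a\<le>k. divpow a \<phi> (derive_divpow (k - a) \<phi> ?D x y))"
    by (simp only: divpow_Suc(2)[OF \<phi>] lin_simps(6)[OF \<phi>])
      (simp only: divpow_Suc(3) lin_simps(2)[OF lin_divpow[OF \<phi>], symmetric])
  also have "\<dots> = \<phi> (\<Sum>a\<le>k. B (divpow a \<phi> x) (divpow (k - a) \<phi> y)) +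
      (\<Sum>a\<le>k. ?D (divpow a \<phi> x) (divpow (k - a) \<phi> y))"
    by (simp only: Suc.IH[OF Suc.prems] Suc.IH[OF bilin_derive[OF \<phi> Suc.prems]])
  \<comment> \<open>The negative term in \<open>derive_bilinear\<close> cancels the first sum; what
    remains is the product rule applied to the right-hand side.\<close>
  also have "\<dots> = (\<Sum>a\<le>k. B (\<phi> (divpow a \<phi> x)) (divpow (k - a) \<phi> y)) +
      (\<Sum>a\<le>k. B (divpow a \<phi> x) (\<phi> (divpow (k - a) \<phi> y)))"
    by (simp add: derive_bilinear_def lin_simps[OF \<phi>] sum.distrib sum_subtractf)
  also have "\<dots> = (\<Sum>a\<le>k. scale (of_nat (Suc a)) (B (divpow (Suc a) \<phi> x) (divpow (k - a) \<phi> y))) +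
      (\<Sum>a\<le>k. scale (of_nat (Suc (k - a))) (B (divpow a \<phi> x) (divpow (Suc (k - a)) \<phi> y)))"
    by (simp only: divpow_Suc(2)[OF \<phi>, symmetric] B)
  also have "\<dots> = scale ?c (\<Sum>a\<le>Suc k. B (divpow a \<phi> x) (divpow (Suc k - a) \<phi> y))"
    by (rule scale_sum_antidiagonal[symmetric])
  \<comment> \<open>Cancelling the scalar \<open>Suc k\<close> is possible in characteristic
    zero.\<close>
  finally show ?case
    by (rule scale_left_imp_eq[OF of_nat_neq_0])
qed

text \<open>Coefficient \<open>i\<close> of exp(t^N \<open>\<phi>\<close>) as a series in
  \<open>t\<close>. Its companion \<open>exp_derive_coeff\<close> is the coefficient of exp(t^N D)
  applied to \<open>B\<close>, where D is \<open>derive_bilinear \<phi>\<close>.\<close>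

definition exp_coeff :: "nat \<Rightarrow> ('v \<Rightarrow> 'v) \<Rightarrow> nat \<Rightarrow> 'v \<Rightarrow> 'v"
  where "exp_coeff N \<phi> i x = (if N dvd i then divpow (i div N) \<phi> x else 0)"

definition exp_derive_coeff :: "nat \<Rightarrow> ('v \<Rightarrow> 'v) \<Rightarrow> nat \<Rightarrow> ('v \<Rightarrow> 'v \<Rightarrow> 'v) \<Rightarrow> 'v \<Rightarrow> 'v \<Rightarrow> 'v"
  where "exp_derive_coeff N \<phi> i B x y = (if N dvd i then derive_divpow (i div N) \<phi> B x y else 0)"

lemma lin_exp_coeff: "lin \<phi> \<Longrightarrow> lin (exp_coeff N \<phi> i)"
  using lin_divpow unfolding exp_coeff_def by (cases "N dvd i") (auto simp: lin_iff)

text \<open>In degree \<open>N * k\<close> only multiples of \<open>N\<close> contribute, which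
  leaves \<open>divpow_intertwines\<close> at \<open>k\<close>. In any other degree each summand has
  a factor whose degree is not a multiple of \<open>N\<close>, and so vanishes.\<close>

lemma exp_coeff_intertwines:
  assumes \<phi>: "lin \<phi>" and B: "bilin B" and N: "N \<ge> 1"
  shows "(\<Sum>i\<le>l. exp_coeff N \<phi> i (exp_derive_coeff N \<phi> (l - i) B x y)) =
    (\<Sum>i\<le>l. B (exp_coeff N \<phi> i x) (exp_coeff N \<phi> (l - i) y))" (is "sum ?f _ = sum ?g _")
proof (cases "N dvd l")
  case True
  then obtain k where l: "l = N * k" by (elim dvdE)
  have "sum ?f {..l} = (\<Sum>a\<le>k. ?f (N * a))" unfolding l
    by (rule sum_multiples[OF N]) (simp add: exp_coeff_def)
  also have "\<dots> = (\<Sum>a\<le>k. divpow a \<phi> (derive_divpow (k - a) \<phi> B x y))"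
    using N by (simp add: exp_coeff_def exp_derive_coeff_def l flip: diff_mult_distrib2)
  also have "\<dots> = (\<Sum>a\<le>k. B (divpow a \<phi> x) (divpow (k - a) \<phi> y))"
    by (rule divpow_intertwines[OF \<phi> B])
  also have "\<dots> = (\<Sum>a\<le>k. ?g (N * a))"
    using N by (simp add: exp_coeff_def exp_derive_coeff_def l flip: diff_mult_distrib2)
  also have "\<dots> = sum ?g {..l}" unfolding l
    by (rule sum_multiples[OF N, symmetric]) (simp add: exp_coeff_def bilin_simps[OF B])
  finally show ?thesis .
next
  case False
  have *: "\<not> N dvd i \<or> \<not> N dvd (l - i)" if "i \<le> l" for i
    using False that by (metis dvd_add le_add_diff_inverse)
  have "sum ?f {..l} = 0"
    using * by (intro sum.neutral)
      (auto simp: exp_coeff_def[of N _ "l - _"] exp_derive_coeff_def lin_simps[OF lin_exp_coeff[OF \<phi>]],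
        auto simp: exp_coeff_def)
  moreover have "sum ?g {..l} = 0"
    using * by (intro sum.neutral) (auto simp: exp_coeff_def bilin_simps[OF B])
  ultimately show ?thesis by simp
qed

text \<open>The series exp(t^N D) M with D = \<open>derive_bilinear \<phi>\<close>. It is the
  conjugate of \<open>M\<close> by exp(t^N \<open>\<phi>\<close>), written so that no inverse
  automorphism appears and membership in \<open>Der\<^sup>1\<close> can be read off term by
  term.\<close>

definition exp_conjugate :: "nat \<Rightarrow> ('v \<Rightarrow> 'v) \<Rightarrow> (nat \<Rightarrow> 'v \<Rightarrow> 'v \<Rightarrow> 'v) \<Rightarrow> nat \<Rightarrow> 'v \<Rightarrow> 'v \<Rightarrow> 'v"
  where "exp_conjugate N \<phi> M n x y = (\<Sum>j\<le>n. exp_derive_coeff N \<phi> j (M (n - j)) x y)"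

text \<open>Sorting both sides by the total degree \<open>l\<close> of the exponential factors
  leaves one fixed bilinear map \<open>M (n - l)\<close>, to which
  \<open>exp_coeff_intertwines\<close> applies.\<close>

lemma exp_conjugate_intertwines:
  assumes \<phi>: "lin \<phi>" and M: "\<And>i. bilin (M i)" and N: "N \<ge> 1"
  shows "(\<Sum>i\<le>n. exp_coeff N \<phi> i (exp_conjugate N \<phi> M (n - i) x y)) =
    (\<Sum>i\<le>n. \<Sum>j\<le>n - i. M i (exp_coeff N \<phi> j x) (exp_coeff N \<phi> (n - i - j) y))"
proof -
  have "(\<Sum>i\<le>n. exp_coeff N \<phi> i (exp_conjugate N \<phi> M (n - i) x y)) =
      (\<Sum>i\<le>n. \<Sum>j\<le>n - i. exp_coeff N \<phi> i (exp_derive_coeff N \<phi> j (M (n - (i + j))) x y))"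
    by (simp add: exp_conjugate_def lin_simps[OF lin_exp_coeff[OF \<phi>]])
  also have "\<dots> = (\<Sum>l\<le>n. \<Sum>i\<le>l. exp_coeff N \<phi> i (exp_derive_coeff N \<phi> (l - i) (M (n - (i + (l - i)))) x y))"
    by (rule sum_triangle)
  also have "\<dots> = (\<Sum>l\<le>n. \<Sum>i\<le>l. exp_coeff N \<phi> i (exp_derive_coeff N \<phi> (l - i) (M (n - l)) x y))"
    by simp
  also have "\<dots> = (\<Sum>l\<le>n. \<Sum>i\<le>l. M (n - l) (exp_coeff N \<phi> i x) (exp_coeff N \<phi> (l - i) y))"
    by (simp only: exp_coeff_intertwines[OF \<phi> M N])
  also have "\<dots> = (\<Sum>i\<le>n. \<Sum>j\<le>n - i. M i (exp_coeff N \<phi> j x) (exp_coeff N \<phi> (n - i - j) y))"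
    by (rule sum.reindex_bij_witness[where i = "\<lambda>i. n - i" and j = "\<lambda>i. n - i"]) auto
  finally show ?thesis .
qed

lemma exp_conjugate_below:
  assumes "n < N"
  shows "exp_conjugate N \<phi> M n = M n"
proof (intro ext)
  fix x y
  have "exp_conjugate N \<phi> M n x y = (\<Sum>j\<le>n. if j = 0 then M n x y else 0)"
    unfolding exp_conjugate_def
    by (rule sum.cong) (use assms in \<open>auto simp: exp_derive_coeff_def dest!: dvd_imp_le\<close>)
  then show "exp_conjugate N \<phi> M n x y = M n x y" by simp
qed

text \<open>Up to degree \<open>N\<close> the exponential has only its terms in degrees 0 and
  \<open>N\<close>; the latter meets \<open>M 0\<close> and gives the first-order change of the
  bracket.\<close>

lemma exp_conjugate_at:
  assumes "N \<ge> 1"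
  shows "exp_conjugate N \<phi> M N x y = M N x y + derive_bilinear \<phi> (M 0) x y"
proof -
  have "exp_conjugate N \<phi> M N x y =
      (\<Sum>j\<le>N. (if j = 0 then M N x y else 0) + (if j = N then derive_bilinear \<phi> (M 0) x y else 0))"
    unfolding exp_conjugate_def
    by (rule sum.cong)
      (use assms in \<open>auto simp: exp_derive_coeff_def derive_divpow_def dest!: dvd_imp_le\<close>)
  then show ?thesis by (simp add: sum.distrib)
qed

end

section \<open>Cochains of a Lie-Rinehart superalgebra in low degree\<close>

declare add_bit_eq_xor [simp del] mult_bit_eq_and [simp del]

lemma bit_cases: obtains "(d::bit) = 0" | "d = 1"
  by (cases d) auto

lemma psign_simps [simp]: "psign 0 v = v" "psign 1 v = - v" "psign d 0 = 0"
  by (simp_all add: psign_def)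

lemma psign_add: "psign d (u + v) = psign d u + psign d v"
  and psign_diff: "psign d (u - v) = psign d u - psign d v"
  and psign_sum: "psign d (sum f A) = (\<Sum>a\<in>A. psign d (f a))"
  by (simp_all add: psign_def sum_negf)

context super_vector_space
begin

lemma grade_simps:
  "0 \<in> G d" "x \<in> G d \<Longrightarrow> y \<in> G d \<Longrightarrow> x + y \<in> G d" "x \<in> G d \<Longrightarrow> y \<in> G d \<Longrightarrow> x - y \<in> G d"
  "x \<in> G d \<Longrightarrow> - x \<in> G d" "x \<in> G d \<Longrightarrow> scale c x \<in> G d" "x \<in> G d \<Longrightarrow> psign e x \<in> G d"
  "(\<And>a. a \<in> A \<Longrightarrow> f a \<in> G d) \<Longrightarrow> sum f A \<in> G d"
  using subspace_grade[of d]
  by (auto simp: psign_def subspace_0 subspace_add subspace_diff subspace_neg subspace_scale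
      intro: subspace_sum)

lemma grade_disjoint:
  assumes "x \<in> G d" "x \<in> G (d + 1)" shows "x = 0"
  using assms grade_inter by (cases d rule: bit_cases) auto

lemma grade_decomp:
  obtains x0 x1 where "x0 \<in> G 0" "x1 \<in> G 1" "x = x0 + x1"
  using grade_sum by blast

text \<open>This collapses the sum over parity patterns in \<open>circ\<close>: on homogeneous
  arguments only the pattern of their actual degrees survives.\<close>

lemma hcomp_homogeneous:
  assumes "x \<in> G d" shows "hcomp G e x = (if e = d then x else 0)"
  unfolding hcomp_def
proof (rule the_equality)
  have e: "e \<noteq> d \<Longrightarrow> e + 1 = d" by (cases e rule: bit_cases; cases d rule: bit_cases) auto
  show "(if e = d then x else 0) \<in> G e \<and> x - (if e = d then x else 0) \<in> G (e + 1)"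
    using assms e by (auto simp: grade_simps)
  fix u assume u: "u \<in> G e \<and> x - u \<in> G (e + 1)"
  show "u = (if e = d then x else 0)"
  proof (cases "e = d")
    case True
    with u assms have "x - u \<in> G d" by (simp add: grade_simps)
    with u True have "x - u = 0" using grade_disjoint by blast
    with True show ?thesis by simp
  next
    case False
    with assms e have "x \<in> G (e + 1)" by simp
    with u have "x - (x - u) \<in> G (e + 1)" using grade_simps(3) by blast
    then have "u \<in> G (e + 1)" by simp
    with u have "u = 0" using grade_disjoint by blast
    with False show ?thesis by simp
  qed
qed

end

text \<open>Passes from curried maps, on which the exponentials act, to functions on lists as used
  in the complex. The value zero on other lengths is the convention of
  \<open>Der_hom\<close>.\<close>

definition binary_cochain :: "('l \<Rightarrow> 'l \<Rightarrow> 'l) \<Rightarrow> 'l list \<Rightarrow> 'l::zero"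
  where "binary_cochain B xs = (if length xs = 2 then B (xs ! 0) (xs ! 1) else 0)"

lemma binary_cochain_pair [simp]: "binary_cochain B [x, y] = B x y"
  by (simp add: binary_cochain_def)

lemma length_2_cases:
  assumes "length xs = 2" obtains x y where "xs = [x, y]"
  using assms by (auto simp: numeral_2_eq_2 length_Suc_conv)

lemma homogeneous_list_simps [simp]:
  "homogeneous_list G ds [] \<longleftrightarrow> ds = []"
  "homogeneous_list G ds (x # xs) \<longleftrightarrow> (\<exists>d ds'. ds = d # ds' \<and> x \<in> G d \<and> homogeneous_list G ds' xs)"
  by (auto simp: homogeneous_list_def list_all2_Cons2)

locale lie_rinehart_superalgebra_char_0 = lie_rinehart_superalgebra S
  for S :: "('k::field_char_0, 'a::ring, 'l::ab_group_add) lie_rinehart" (structure)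
begin

sublocale A: supercommutative_algebra "scaleA S" "gradeA S"
  by (rule algebra_A)

sublocale L: lie_superalgebra "scaleL S" "gradeL S" "bracketL S"
  by (rule lie_L)

sublocale V: char_0_vector_space "scaleL S"
  by unfold_locales

lemma lin_A_iff: "Vector_Spaces.linear (scaleA S) (scaleA S) f \<longleftrightarrow>
    (\<forall>x y. f (x + y) = f x + f y) \<and> (\<forall>c x. f (scaleA S c x) = scaleA S c (f x))"
  by (simp add: Vector_Spaces.linear_iff A.vector_space_axioms)

lemma lin_LA_iff: "Vector_Spaces.linear (scaleL S) (scaleA S) f \<longleftrightarrow>
    (\<forall>x y. f (x + y) = f x + f y) \<and> (\<forall>c x. f (scaleL S c x) = scaleA S c (f x))"
  by (simp add: Vector_Spaces.linear_iff A.vector_space_axioms L.vector_space_axioms)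

lemma act_simps:
  "act S (a + b) x = act S a x + act S b x" "act S 0 x = 0" "act S (- a) x = - act S a x"
  "act S (a - b) x = act S a x - act S b x" "act S (scaleA S c a) x = scaleL S c (act S a x)"
  "act S (psign d a) x = psign d (act S a x)"
  "act S a (x + y) = act S a x + act S a y" "act S a 0 = 0" "act S a (- x) = - act S a x"
  "act S a (x - y) = act S a x - act S a y" "act S a (scaleL S c x) = scaleL S c (act S a x)"
  "act S a (psign d x) = psign d (act S a x)"
proof -
  interpret l: Vector_Spaces.linear "scaleA S" "scaleL S" "\<lambda>a. act S a x" for x
    by (rule act_linear_left)
  interpret r: Vector_Spaces.linear "scaleL S" "scaleL S" "act S a" for a
    by (rule act_linear_right)
  show "act S (a + b) x = act S a x + act S b x" "act S 0 x = 0" "act S (- a) x = - act S a x"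
    "act S (a - b) x = act S a x - act S b x" "act S (scaleA S c a) x = scaleL S c (act S a x)"
    "act S (psign d a) x = psign d (act S a x)"
    by (simp_all add: l.add l.scale l.neg l.diff psign_def)
  show "act S a (x + y) = act S a x + act S a y" "act S a 0 = 0" "act S a (- x) = - act S a x"
    "act S a (x - y) = act S a x - act S a y" "act S a (scaleL S c x) = scaleL S c (act S a x)"
    "act S a (psign d x) = psign d (act S a x)"
    by (simp_all add: r.add r.scale r.neg r.diff psign_def)
qed

lemma bilin_bracket: "V.bilin (bracketL S)"
  unfolding V.bilin_def using L.linear_left L.linear_right by blast

lemma bilin_eqI:
  assumes "V.bilin B" "V.bilin C"
    and "\<And>d e x y. x \<in> gradeL S d \<Longrightarrow> y \<in> gradeL S e \<Longrightarrow> B x y = C x y"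
  shows "B x y = C x y"
proof -
  obtain x0 x1 y0 y1 where "x0 \<in> gradeL S 0" "x1 \<in> gradeL S 1" "x = x0 + x1"
    "y0 \<in> gradeL S 0" "y1 \<in> gradeL S 1" "y = y0 + y1"
    using L.grade_decomp by metis
  then show ?thesis
    by (simp add: V.bilin_simps[OF assms(1)] V.bilin_simps[OF assms(2)] assms(3))
qed

section \<open>Superderivations of the algebra \<open>A\<close>\<close>

abbreviation Der_A :: "('a \<Rightarrow> 'a) set"
  where "Der_A \<equiv> Der_alg (scaleA S) (gradeA S)"

abbreviation superder_A :: "bit \<Rightarrow> ('a \<Rightarrow> 'a) set"
  where "superder_A \<equiv> superderivations (scaleA S) (gradeA S)"

lemma superder_zero: "(\<lambda>_. 0) \<in> superder_A j"
  by (auto simp: superderivations_def lin_A_iff A.grade_simps)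

lemma superder_add:
  "D \<in> superder_A j \<Longrightarrow> E \<in> superder_A j \<Longrightarrow> (\<lambda>a. D a + E a) \<in> superder_A j"
  by (auto simp: superderivations_def lin_A_iff A.grade_simps A.scale_right_distrib algebra_simps psign_add)

lemma superder_scale:
  assumes "D \<in> superder_A j" shows "(\<lambda>a. scaleA S c (D a)) \<in> superder_A j"
proof -
  have "psign d (a * scaleA S c b) = scaleA S c (psign d (a * b))" for d a b
    by (simp add: psign_def A.scale_mult_right)
  with assms show ?thesis
    by (auto simp: superderivations_def lin_A_iff A.grade_simps A.scale_right_distrib A.scale_mult_left mult.commute)
qed

text \<open>As \<open>\<tau>\<close> is even, the supercommutator carries no sign and the degree of
  \<open>a\<close> is unchanged under \<open>\<tau>\<close>; the mixed products of
  \<open>D a\<close> with \<open>\<tau> b\<close> and of \<open>\<tau> a\<close> with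
  \<open>D b\<close> then cancel.\<close>

lemma superder_commutator:
  assumes D: "D \<in> superder_A j" and \<tau>: "\<tau> \<in> superder_A 0"
  shows "(\<lambda>a. D (\<tau> a) - \<tau> (D a)) \<in> superder_A j"
proof -
  have lin: "D (a + b) = D a + D b" "\<tau> (a + b) = \<tau> a + \<tau> b" "D (scaleA S c a) = scaleA S c (D a)"
      "\<tau> (scaleA S c a) = scaleA S c (\<tau> a)" for a b c
    using D \<tau> by (auto simp: superderivations_def lin_A_iff)
  have neg: "\<tau> (- a) = - \<tau> a" for a
    using lin(2)[of a "- a"] lin(2)[of 0 0] by (simp add: eq_neg_iff_add_eq_0 add.commute)
  have ps: "\<tau> (psign d a) = psign d (\<tau> a)" for d a
    by (simp add: psign_def neg)
  have gr: "a \<in> gradeA S d \<Longrightarrow> D a \<in> gradeA S (d + j)" "a \<in> gradeA S d \<Longrightarrow> \<tau> a \<in> gradeA S d" for a d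
    using D \<tau> by (auto simp: superderivations_def)
  have "D (a * b) = D a * b + psign (d * j) (a * D b)" "\<tau> (a * b) = \<tau> a * b + a * \<tau> b"
    if "a \<in> gradeA S d" "b \<in> gradeA S e" for a b d e
    using D \<tau> that by (auto simp: superderivations_def)
  note der = this
  have "D (\<tau> (a * b)) - \<tau> (D (a * b)) =
      (D (\<tau> a) - \<tau> (D a)) * b + psign (d * j) (a * (D (\<tau> b) - \<tau> (D b)))"
    if a: "a \<in> gradeA S d" and b: "b \<in> gradeA S e" for a b d e
    using der[OF a b] der[OF gr(2)[OF a] b] der[OF a gr(2)[OF b]] der(2)[OF gr(1)[OF a] b]
      der(2)[OF a gr(1)[OF b]]
    by (simp add: lin ps psign_add psign_diff algebra_simps)
  then show ?thesis
    by (auto simp: superderivations_def lin_A_iff lin A.scale_right_diff_distrib gr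
        intro!: A.grade_simps)
qed

lemma Der_A_zero: "(\<lambda>_. 0) \<in> Der_A"
  unfolding Der_alg_def using superder_zero by force

lemma Der_A_add:
  assumes "D \<in> Der_A" "E \<in> Der_A" shows "(\<lambda>a. D a + E a) \<in> Der_A"
proof -
  obtain D0 D1 E0 E1 where "D = (\<lambda>a. D0 a + D1 a)" "E = (\<lambda>a. E0 a + E1 a)"
    "D0 \<in> superder_A 0" "D1 \<in> superder_A 1" "E0 \<in> superder_A 0" "E1 \<in> superder_A 1"
    using assms unfolding Der_alg_def by blast
  then show ?thesis
    unfolding Der_alg_def mem_Collect_eq
    by (intro exI[of _ "\<lambda>a. D0 a + E0 a"] exI[of _ "\<lambda>a. D1 a + E1 a"])
      (auto simp: superder_add add_ac)
qed

lemma Der_A_scale: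
  assumes "D \<in> Der_A" shows "(\<lambda>a. scaleA S c (D a)) \<in> Der_A"
proof -
  obtain D0 D1 where "D = (\<lambda>a. D0 a + D1 a)" "D0 \<in> superder_A 0" "D1 \<in> superder_A 1"
    using assms unfolding Der_alg_def by blast
  then show ?thesis
    unfolding Der_alg_def mem_Collect_eq
    by (intro exI[of _ "\<lambda>a. scaleA S c (D0 a)"] exI[of _ "\<lambda>a. scaleA S c (D1 a)"])
      (auto simp: superder_scale A.scale_right_distrib)
qed

lemma Der_A_commutator:
  assumes "D \<in> Der_A" and \<tau>: "\<tau> \<in> superder_A 0"
  shows "(\<lambda>a. D (\<tau> a) - \<tau> (D a)) \<in> Der_A"
proof -
  obtain D0 D1 where "D = (\<lambda>a. D0 a + D1 a)" "D0 \<in> superder_A 0" "D1 \<in> superder_A 1"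
    using assms unfolding Der_alg_def by blast
  moreover have "\<tau> (a + b) = \<tau> a + \<tau> b" for a b
    using \<tau> by (auto simp: superderivations_def lin_A_iff)
  ultimately show ?thesis
    unfolding Der_alg_def mem_Collect_eq
    by (intro exI[of _ "\<lambda>a. D0 (\<tau> a) - \<tau> (D0 a)"] exI[of _ "\<lambda>a. D1 (\<tau> a) - \<tau> (D1 a)"])
      (auto simp: superder_commutator \<tau>)
qed

section \<open>Even binary cochains and their symbols\<close>

definition symbol_of :: "('l \<Rightarrow> 'l \<Rightarrow> 'l) \<Rightarrow> ('l \<Rightarrow> 'a \<Rightarrow> 'a) \<Rightarrow> bool"
  where "symbol_of B \<sigma> \<longleftrightarrow> (\<forall>x. \<sigma> x \<in> Der_A) \<and>
    (\<forall>a. Vector_Spaces.linear (scaleL S) (scaleA S) (\<lambda>x. \<sigma> x a)) \<and>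
    (\<forall>d e f. \<forall>a\<in>gradeA S d. \<forall>x\<in>gradeL S e. \<forall>y\<in>gradeL S f.
      B x (act S a y) = psign (d * e) (act S a (B x y)) + act S (\<sigma> x a) y)"

text \<open>The curried counterpart of \<open>Der_hom S 0 1\<close>;
  \<open>binary_cochain_Der_hom\<close> and \<open>Der_hom_binary_cochain\<close> translate in the
  two directions.\<close>

definition even_Der1 :: "('l \<Rightarrow> 'l \<Rightarrow> 'l) \<Rightarrow> bool"
  where "even_Der1 B \<longleftrightarrow> V.bilin B \<and>
    (\<forall>d e. \<forall>x\<in>gradeL S d. \<forall>y\<in>gradeL S e.
      B x y \<in> gradeL S (d + e) \<and> B x y = - psign (d * e) (B y x)) \<and>
    (\<exists>\<sigma>. symbol_of B \<sigma>)"

lemma multilinear_2_iff: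
  "multilinear 2 (scaleL S) (scaleL S) f \<longleftrightarrow> V.bilin (\<lambda>x y. f [x, y])"
proof
  assume f: "multilinear 2 (scaleL S) (scaleL S) f"
  have "V.lin (\<lambda>v. f ([x, y][i := v]))" if "i < 2" for x y i
  proof -
    have "length [x, y] = 2" by simp
    with f that show ?thesis unfolding multilinear_def by blast
  qed
  from this[of 0] this[of 1] show "V.bilin (\<lambda>x y. f [x, y])"
    by (simp add: V.bilin_def)
next
  assume f: "V.bilin (\<lambda>x y. f [x, y])"
  show "multilinear 2 (scaleL S) (scaleL S) f"
    unfolding multilinear_def
  proof (intro allI impI)
    fix xs :: "'l list" and i :: nat assume "length xs = 2" "i < 2"
    then show "V.lin (\<lambda>v. f (xs[i := v]))"
      using f by (auto elim!: length_2_cases simp: V.bilin_def less_2_cases_iff)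
  qed
qed

lemma multilinear_1_iff:
  "multilinear 1 (scaleL S) s f \<longleftrightarrow> Vector_Spaces.linear (scaleL S) s (\<lambda>x. f [x])"
  unfolding multilinear_def
  by (auto simp: length_Suc_conv)

lemma binary_cochain_Der_hom:
  assumes "even_Der1 B" shows "binary_cochain B \<in> Der_hom S 0 1"
proof -
  obtain \<sigma> where \<sigma>: "symbol_of B \<sigma>" using assms by (auto simp: even_Der1_def)
  have "is_symbol S 0 1 (binary_cochain B) (\<lambda>xs. \<sigma> (xs ! 0))"
    unfolding is_symbol_def multilinear_1_iff
  proof (intro conjI allI impI)
    fix ds xs d a e y
    assume xs: "length xs = 1" "homogeneous_list (gradeL S) ds xs"
      and a: "a \<in> gradeA S d" and y: "y \<in> gradeL S e"
    from xs obtain x d' where "xs = [x]" "ds = [d']" "x \<in> gradeL S d'"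
      by (cases xs) auto
    with \<sigma> a y show "binary_cochain B (xs @ [act S a y]) =
        psign (d * (0 + sum_list ds)) (act S a (binary_cochain B (xs @ [y]))) + act S (\<sigma> (xs ! 0) a) y"
      by (simp add: symbol_of_def)
  qed (use \<sigma> in \<open>simp_all add: symbol_of_def\<close>)
  moreover have "binary_cochain B xs \<in> gradeL S (0 + sum_list ds) \<and>
      binary_cochain B xs = - psign (ds ! 0 * ds ! 1) (binary_cochain B (xs[0 := xs ! 1, 1 := xs ! 0]))"
    if xs: "length xs = 2" "homogeneous_list (gradeL S) ds xs" for ds xs
  proof -
    obtain x y where "xs = [x, y]" using xs(1) by (rule length_2_cases)
    with xs obtain d e where *: "ds = [d, e]" "x \<in> gradeL S d" "y \<in> gradeL S e" by auto
    then have "B x y \<in> gradeL S (d + e)" "B x y = - psign (d * e) (B y x)"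
      using assms unfolding even_Der1_def by blast+
    with *(1) \<open>xs = [x, y]\<close> show ?thesis by simp
  qed
  moreover have "V.bilin (\<lambda>x y. binary_cochain B [x, y])"
    using assms by (simp add: even_Der1_def)
  moreover have "binary_cochain B xs = 0" if "length xs \<noteq> 2" for xs
    using that by (simp add: binary_cochain_def)
  ultimately show ?thesis
    unfolding Der_hom_def one_add_one mem_Collect_eq multilinear_2_iff less_one
    by (metis add_0)
qed

lemma Der_hom_binary_cochain:
  assumes f: "f \<in> Der_hom S 0 1"
  shows "even_Der1 (\<lambda>x y. f [x, y])" and "f = binary_cochain (\<lambda>x y. f [x, y])"
proof -
  have hom: "f xs \<in> gradeL S (0 + sum_list ds)"
    if "length xs = 2" "homogeneous_list (gradeL S) ds xs" for ds xs
    using f that unfolding Der_hom_def one_add_one mem_Collect_eq by blast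
  have skew: "f xs = - psign (ds ! i * ds ! (i + 1)) (f (xs[i := xs ! (i + 1), i + 1 := xs ! i]))"
    if "length xs = 2" "homogeneous_list (gradeL S) ds xs" "i < 1" for ds xs i
    using f that unfolding Der_hom_def one_add_one mem_Collect_eq by blast
  obtain \<sigma> where \<sigma>: "is_symbol S 0 1 f \<sigma>" using f unfolding Der_hom_def by blast
  have symbol: "f (xs @ [act S a y]) =
      psign (d * (0 + sum_list ds)) (act S a (f (xs @ [y]))) + act S (\<sigma> xs a) y"
    if "length xs = 1" "homogeneous_list (gradeL S) ds xs" "a \<in> gradeA S d" "y \<in> gradeL S f'"
    for a xs ds y d f'
    using \<sigma> that unfolding is_symbol_def by blast
  have "f [x, act S a y] = psign (d * e) (act S a (f [x, y])) + act S (\<sigma> [x] a) y"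
    if "a \<in> gradeA S d" "x \<in> gradeL S e" "y \<in> gradeL S f'" for a x y d e f'
    using symbol[of "[x]" "[e]" a d y f'] that by simp
  moreover have "\<sigma> [x] \<in> Der_A" "Vector_Spaces.linear (scaleL S) (scaleA S) (\<lambda>x. \<sigma> [x] a)" for x a
    using \<sigma> unfolding is_symbol_def multilinear_1_iff by auto
  ultimately have "symbol_of (\<lambda>x y. f [x, y]) (\<lambda>x. \<sigma> [x])"
    unfolding symbol_of_def by simp
  moreover have "V.bilin (\<lambda>x y. f [x, y])"
    using f unfolding Der_hom_def one_add_one mem_Collect_eq multilinear_2_iff by blast
  moreover have "f [x, y] \<in> gradeL S (d + e)" "f [x, y] = - psign (d * e) (f [y, x])"
    if "x \<in> gradeL S d" "y \<in> gradeL S e" for x y d e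
    using hom[of "[x, y]" "[d, e]"] skew[of "[x, y]" "[d, e]" 0] that by simp_all
  ultimately show "even_Der1 (\<lambda>x y. f [x, y])"
    unfolding even_Der1_def by blast
  show "f = binary_cochain (\<lambda>x y. f [x, y])"
  proof
    fix xs show "f xs = binary_cochain (\<lambda>x y. f [x, y]) xs"
      using f by (cases "length xs = 2") (auto simp: Der_hom_def binary_cochain_def elim!: length_2_cases)
  qed
qed

lemma even_Der1_zero: "even_Der1 (\<lambda>_ _. 0)"
proof -
  have "symbol_of (\<lambda>_ _. 0) (\<lambda>_ _. 0)"
    by (simp add: symbol_of_def Der_A_zero lin_LA_iff act_simps)
  then show ?thesis
    by (auto simp: even_Der1_def V.bilin_def V.lin_iff L.grade_simps)
qed

lemma even_Der1_add:
  assumes "even_Der1 B" "even_Der1 C" shows "even_Der1 (\<lambda>x y. B x y + C x y)"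
proof -
  have B: "V.bilin B" and C: "V.bilin C" using assms by (auto simp: even_Der1_def)
  have "V.bilin (\<lambda>x y. B x y + C x y)"
    unfolding V.bilin_def V.lin_iff
    by (simp add: V.bilin_simps[OF B] V.bilin_simps[OF C] L.scale_right_distrib)
  moreover obtain \<sigma> \<tau> where "symbol_of B \<sigma>" "symbol_of C \<tau>"
    using assms by (auto simp: even_Der1_def)
  then have "symbol_of (\<lambda>x y. B x y + C x y) (\<lambda>x a. \<sigma> x a + \<tau> x a)"
    by (simp add: symbol_of_def Der_A_add lin_LA_iff act_simps A.scale_right_distrib psign_add)
  moreover have "B x y + C x y = - psign (d * e) (B y x + C y x)"
    if x: "x \<in> gradeL S d" and y: "y \<in> gradeL S e" for x y d e
  proof -
    have "B x y = - psign (d * e) (B y x)" "C x y = - psign (d * e) (C y x)"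
      using assms x y unfolding even_Der1_def by blast+
    then show ?thesis by (simp only: psign_add minus_add_distrib)
  qed
  ultimately show ?thesis
    using assms unfolding even_Der1_def by (blast intro: L.grade_simps)
qed

lemma even_Der1_scale:
  assumes "even_Der1 B" shows "even_Der1 (\<lambda>x y. scaleL S c (B x y))"
proof -
  have B: "V.bilin B" using assms by (auto simp: even_Der1_def)
  have ps: "psign d (scaleL S c x) = scaleL S c (psign d x)" for d x
    by (simp add: psign_def)
  have "V.bilin (\<lambda>x y. scaleL S c (B x y))"
    unfolding V.bilin_def V.lin_iff
    by (simp add: V.bilin_simps[OF B] L.scale_right_distrib mult.commute)
  moreover obtain \<sigma> where "symbol_of B \<sigma>"
    using assms by (auto simp: even_Der1_def)
  then have "symbol_of (\<lambda>x y. scaleL S c (B x y)) (\<lambda>x a. scaleA S c (\<sigma> x a))"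
    by (simp add: symbol_of_def Der_A_scale lin_LA_iff act_simps A.scale_right_distrib
        L.scale_right_distrib ps mult.commute)
  moreover have "scaleL S c (B x y) = - psign (d * e) (scaleL S c (B y x))"
    if x: "x \<in> gradeL S d" and y: "y \<in> gradeL S e" for x y d e
  proof -
    have "B x y = - psign (d * e) (B y x)"
      using assms x y unfolding even_Der1_def by blast
    then show ?thesis by (simp only: ps L.scale_minus_right)
  qed
  ultimately show ?thesis
    using assms unfolding even_Der1_def by (blast intro: L.grade_simps)
qed

lemma even_Der1_sum:
  assumes "finite I" "\<And>i. i \<in> I \<Longrightarrow> even_Der1 (B i)"
  shows "even_Der1 (\<lambda>x y. \<Sum>i\<in>I. B i x y)"
  using assms by (induction I rule: finite_induct) (auto intro: even_Der1_zero even_Der1_add)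

text \<open>Evenness of \<open>\<tau>\<close> is demanded, beyond membership in
  \<open>Der_A\<close>, so that its plain commutator with a symbol is again in
  \<open>Der_A\<close>.\<close>

definition even_module_derivation :: "('l \<Rightarrow> 'l) \<Rightarrow> ('a \<Rightarrow> 'a) \<Rightarrow> bool"
  where "even_module_derivation \<phi> \<tau> \<longleftrightarrow> V.lin \<phi> \<and> (\<forall>d. \<forall>x\<in>gradeL S d. \<phi> x \<in> gradeL S d) \<and>
    \<tau> \<in> superder_A 0 \<and> (\<forall>a x. \<phi> (act S a x) = act S a (\<phi> x) + act S (\<tau> a) x)"

text \<open>The new symbol at \<open>x\<close> is \<open>\<sigma> (\<phi> x)\<close> plus the
  commutator of \<open>\<sigma> x\<close> with \<open>\<tau>\<close>. In the Leibniz rule for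
  \<open>act S a y\<close>, the terms in which \<open>\<sigma> x a\<close> acts on
  \<open>\<phi> y\<close>, and those in which \<open>\<tau> a\<close> acts on \<open>B x y\<close>,
  occur once in \<open>B x (\<phi> (act S a y))\<close> and once in
  \<open>\<phi> (B x (act S a y))\<close>, so they cancel.\<close>

lemma even_Der1_derive:
  assumes \<phi>: "even_module_derivation \<phi> \<tau>" and B: "even_Der1 B"
  shows "even_Der1 (derive_bilinear \<phi> B)"
proof -
  have bil: "V.bilin B" using B by (simp add: even_Der1_def)
  have lin: "V.lin \<phi>" and gr: "\<And>d x. x \<in> gradeL S d \<Longrightarrow> \<phi> x \<in> gradeL S d"
    and \<tau>: "\<tau> \<in> superder_A 0"
    and der: "\<And>a x. \<phi> (act S a x) = act S a (\<phi> x) + act S (\<tau> a) x"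
    using \<phi> by (auto simp: even_module_derivation_def)
  have \<tau>gr: "a \<in> gradeA S d \<Longrightarrow> \<tau> a \<in> gradeA S d" for a d
    using \<tau> by (auto simp: superderivations_def)
  have \<tau>lin: "\<tau> (a + b) = \<tau> a + \<tau> b" "\<tau> (scaleA S c a) = scaleA S c (\<tau> a)" for a b c
    using \<tau> by (auto simp: superderivations_def lin_A_iff)
  note lins = V.lin_simps[OF lin] and bils = V.bilin_simps[OF bil]
  obtain \<sigma> where \<sigma>: "symbol_of B \<sigma>" using B by (auto simp: even_Der1_def)
  have \<sigma>lin: "\<sigma> (x + y) a = \<sigma> x a + \<sigma> y a" "\<sigma> (scaleL S c x) a = scaleA S c (\<sigma> x a)" for x y a c
    using \<sigma> by (auto simp: symbol_of_def lin_LA_iff)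
  have \<sigma>mult: "B x (act S a y) = psign (d * e) (act S a (B x y)) + act S (\<sigma> x a) y"
    if "a \<in> gradeA S d" "x \<in> gradeL S e" "y \<in> gradeL S f" for a x y d e f
    using \<sigma> that unfolding symbol_of_def by blast
  let ?\<sigma> = "\<lambda>x a. \<sigma> (\<phi> x) a + (\<sigma> x (\<tau> a) - \<tau> (\<sigma> x a))"
  have "derive_bilinear \<phi> B x (act S a y) =
      psign (d * e) (act S a (derive_bilinear \<phi> B x y)) + act S (?\<sigma> x a) y"
    if a: "a \<in> gradeA S d" and x: "x \<in> gradeL S e" and y: "y \<in> gradeL S f" for a x y d e f
    unfolding derive_bilinear_def
    by (simp add: der bils lins act_simps psign_add psign_diff \<sigma>mult[OF a x y] \<sigma>mult[OF a gr[OF x] y]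
        \<sigma>mult[OF a x gr[OF y]] \<sigma>mult[OF \<tau>gr[OF a] x y] algebra_simps)
  moreover have "?\<sigma> x \<in> Der_A" for x
    using \<sigma> by (intro Der_A_add Der_A_commutator \<tau>) (auto simp: symbol_of_def)
  ultimately have "symbol_of (derive_bilinear \<phi> B) ?\<sigma>"
    unfolding symbol_of_def lin_LA_iff
    by (simp add: lins \<sigma>lin \<tau>lin A.scale_right_distrib A.scale_right_diff_distrib)
  moreover have "derive_bilinear \<phi> B x y \<in> gradeL S (d + e)"
    "derive_bilinear \<phi> B x y = - psign (d * e) (derive_bilinear \<phi> B y x)"
    if x: "x \<in> gradeL S d" and y: "y \<in> gradeL S e" for x y d e
  proof -
    have *: "B x y \<in> gradeL S (d + e)" "B x y = - psign (d * e) (B y x)"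
      if "x \<in> gradeL S d" "y \<in> gradeL S e" for x y
      using B that unfolding even_Der1_def by blast+
    show "derive_bilinear \<phi> B x y \<in> gradeL S (d + e)"
      unfolding derive_bilinear_def by (intro L.grade_simps gr * x y)
    show "derive_bilinear \<phi> B x y = - psign (d * e) (derive_bilinear \<phi> B y x)"
      unfolding derive_bilinear_def *(2)[OF x y] *(2)[OF gr[OF x] y] *(2)[OF x gr[OF y]]
      by (simp add: lins psign_add psign_diff)
  qed
  ultimately show ?thesis
    using V.bilin_derive[OF lin bil] unfolding even_Der1_def by blast
qed

lemma even_Der1_exp_conjugate:
  assumes \<phi>: "even_module_derivation \<phi> \<tau>" and M: "\<And>i. even_Der1 (M i)"
  shows "even_Der1 (V.exp_conjugate N \<phi> M n)"
proof -
  have "even_Der1 ((derive_bilinear \<phi> ^^ k) (M i))" for k i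
    by (induction k) (auto intro: M even_Der1_derive[OF \<phi>])
  then have "even_Der1 (\<lambda>x y. V.exp_derive_coeff N \<phi> j (M i) x y)" for i j
    unfolding V.exp_derive_coeff_def V.derive_divpow_def
    by (cases "N dvd j") (auto intro: even_Der1_zero even_Der1_scale)
  then show ?thesis
    unfolding V.exp_conjugate_def[abs_def] by (intro even_Der1_sum) auto
qed

end

section \<open>Coboundaries and gauge transformations\<close>

lemma unshuffles_1_2: "unshuffles 1 2 = {id, transpose 0 1}"
  and unshuffles_2_2: "unshuffles 2 2 = {id}"
proof -
  have [simp]: "{..<2} = {0, 1 :: nat}" by auto
  show "unshuffles 1 2 = {id, transpose 0 1}"
    unfolding unshuffles_def
    by (auto simp: permutes_doubleton_iff monotone_on_def)
  show "unshuffles 2 2 = {id}"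
    unfolding unshuffles_def
    by (auto simp: permutes_doubleton_iff monotone_on_def)
qed

lemma koszul_exponent_id: "koszul_exponent id ds = 0"
proof -
  have "{(i, j). i < j \<and> j < length ds \<and> id j < id i} = {}" by auto
  then show ?thesis unfolding koszul_exponent_def by (simp only: evenperm_id) simp
qed

lemma koszul_exponent_transpose: "koszul_exponent (transpose 0 1) [d, e] = 1 + d * e"
proof -
  have "{(i, j). i < j \<and> j < length [d, e] \<and> transpose 0 1 j < (transpose 0 1 i :: nat)} = {(0, 1)}"
    by (auto simp: transpose_def less_Suc_eq split: if_splits)
  then show ?thesis
    unfolding koszul_exponent_def by (simp add: evenperm_swap mult.commute)
qed

lemma bit_lists_length_2: "{ds :: bit list. length ds = 2} = {[0, 0], [0, 1], [1, 0], [1, 1]}"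
proof (intro set_eqI iffI)
  fix ds :: "bit list" assume "ds \<in> {ds. length ds = 2}"
  then obtain a b where "ds = [a, b]" by (auto elim: length_2_cases)
  then show "ds \<in> {[0, 0], [0, 1], [1, 0], [1, 1]}"
    by (cases a rule: bit_cases; cases b rule: bit_cases) auto
qed auto

context lie_rinehart_superalgebra_char_0
begin

lemma m_cochain_binary: "m_cochain S = binary_cochain (bracketL S)"
  by (simp add: fun_eq_iff m_cochain_def binary_cochain_def)

text \<open>The two unshuffles give the two terms, the transposition contributing the sign -(-1)^(d
  e). Parity patterns other than \<open>[d, e]\<close> feed a zero into \<open>B\<close> or into
  \<open>\<phi>\<close>, which is where \<open>\<phi> [0] = 0\<close> enters.\<close>

lemma circ_binary_unary:
  assumes B: "V.bilin B" and \<phi>: "\<phi> [0] = 0" and x: "x \<in> gradeL S d" and y: "y \<in> gradeL S e"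
  shows "circ S 1 0 (binary_cochain B) \<phi> [x, y] = B (\<phi> [x]) y - psign (d * e) (B (\<phi> [y]) x)"
proof -
  have *: "circ S 1 0 (binary_cochain B) \<phi> [x, y] =
      (\<Sum>ds | length ds = 2. \<Sum>\<tau>\<in>unshuffles 1 2.
        (let ys = map2 (hcomp (gradeL S)) ds [x, y] in
         psign (koszul_exponent \<tau> ds) (binary_cochain B [\<phi> [ys ! \<tau> 0], ys ! \<tau> 1])))"
    by (simp add: circ_def numeral_2_eq_2)
  have "id \<noteq> transpose 0 (1 :: nat)"
    by (metis id_apply transpose_apply_first zero_neq_one)
  then have "circ S 1 0 (binary_cochain B) \<phi> [x, y] =
      (\<Sum>ds | length ds = 2.
        let u = hcomp (gradeL S) (ds ! 0) x; v = hcomp (gradeL S) (ds ! 1) y in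
        B (\<phi> [u]) v + psign (1 + ds ! 0 * ds ! 1) (B (\<phi> [v]) u))"
    unfolding * unshuffles_1_2 bit_lists_length_2
    by (simp add: Let_def koszul_exponent_id koszul_exponent_transpose[unfolded One_nat_def])
  then show ?thesis
    unfolding bit_lists_length_2
    by (cases d rule: bit_cases; cases e rule: bit_cases)
      (use x y in \<open>simp_all add: Let_def L.hcomp_homogeneous \<phi> V.bilin_simps[OF B]\<close>)
qed

lemma circ_unary_binary:
  assumes B: "V.bilin B" and \<phi>: "\<phi> [0] = 0" and x: "x \<in> gradeL S d" and y: "y \<in> gradeL S e"
  shows "circ S 0 1 \<phi> (binary_cochain B) [x, y] = \<phi> [B x y]"
proof -
  have *: "circ S 0 1 \<phi> (binary_cochain B) [x, y] =
      (\<Sum>ds | length ds = 2. \<Sum>\<tau>\<in>unshuffles 2 2.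
        (let ys = map2 (hcomp (gradeL S)) ds [x, y] in
         psign (koszul_exponent \<tau> ds) (\<phi> [binary_cochain B [ys ! \<tau> 0, ys ! \<tau> 1]])))"
    by (simp add: circ_def numeral_2_eq_2)
  have "circ S 0 1 \<phi> (binary_cochain B) [x, y] =
      (\<Sum>ds | length ds = 2. \<phi> [B (hcomp (gradeL S) (ds ! 0) x) (hcomp (gradeL S) (ds ! 1) y)])"
    unfolding * unshuffles_2_2 bit_lists_length_2
    by (simp add: koszul_exponent_id)
  then show ?thesis
    unfolding bit_lists_length_2
    by (cases d rule: bit_cases; cases e rule: bit_cases)
      (use x y in \<open>simp_all add: L.hcomp_homogeneous \<phi> V.bilin_simps[OF B]\<close>)
qed

text \<open>The bracket sign (-1)^(p q) is trivial because q = 0. Here \<open>\<phi>\<close> may mix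
  parities, as a primitive in \<open>C_def S 1\<close> does; only the arguments are
  homogeneous.\<close>

lemma differential_unary:
  assumes \<phi>: "\<phi> [0] = 0" and x: "x \<in> gradeL S d" and y: "y \<in> gradeL S e"
  shows "differential S 1 \<phi> [x, y] =
    bracketL S (\<phi> [x]) y - psign (d * e) (bracketL S (\<phi> [y]) x) - \<phi> [bracketL S x y]"
  unfolding differential_def Der_bracket_def m_cochain_binary
  using circ_binary_unary[of _ \<phi>, OF bilin_bracket \<phi> x y]
    circ_unary_binary[of _ \<phi>, OF bilin_bracket \<phi> x y] by simp

lemma Der_hom_unary:
  assumes f: "f \<in> Der_hom S j 0"
  shows "V.lin (\<lambda>x. f [x])" and "x \<in> gradeL S d \<Longrightarrow> f [x] \<in> gradeL S (d + j)"
    and "\<exists>D\<in>Der_A. \<forall>d e. \<forall>a\<in>gradeA S d. \<forall>x\<in>gradeL S e.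
      f [act S a x] = psign (d * j) (act S a (f [x])) + act S (D a) x"
proof -
  have "multilinear 1 (scaleL S) (scaleL S) f" using f by (simp add: Der_hom_def)
  then show "V.lin (\<lambda>x. f [x])" by (simp only: multilinear_1_iff)
  have "f xs \<in> gradeL S (j + sum_list ds)"
    if "length xs = 0 + 1" "homogeneous_list (gradeL S) ds xs" for ds xs
    using f that unfolding Der_hom_def by blast
  from this[of "[x]" "[d]"] show "x \<in> gradeL S d \<Longrightarrow> f [x] \<in> gradeL S (d + j)"
    by (simp add: add.commute)
  obtain \<sigma> where \<sigma>: "is_symbol S j 0 f \<sigma>" using f unfolding Der_hom_def by blast
  have "f (xs @ [act S a x]) =
      psign (d * (j + sum_list ds)) (act S a (f (xs @ [x]))) + act S (\<sigma> xs a) x"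
    if "length xs = 0" "homogeneous_list (gradeL S) ds xs" "a \<in> gradeA S d" "x \<in> gradeL S e"
    for xs ds a d x e
    using \<sigma> that unfolding is_symbol_def by blast
  from this[of "[]" "[]"] have "f [act S a x] = psign (d * j) (act S a (f [x])) + act S (\<sigma> [] a) x"
    if "a \<in> gradeA S d" "x \<in> gradeL S e" for a d x e
    using that by simp
  moreover have "\<sigma> [] \<in> Der_A" using \<sigma> by (auto simp: is_symbol_def)
  ultimately show "\<exists>D\<in>Der_A. \<forall>d e. \<forall>a\<in>gradeA S d. \<forall>x\<in>gradeL S e.
      f [act S a x] = psign (d * j) (act S a (f [x])) + act S (D a) x"
    by blast
qed

text \<open>The odd part of a symbol of an even map annihilates \<open>L\<close> by parity, so it can be dropped.\<close>

lemma Der_hom_even_module_derivation: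
  assumes f: "f \<in> Der_hom S 0 0"
  shows "\<exists>\<tau>. even_module_derivation (\<lambda>x. f [x]) \<tau>"
proof -
  note lin = Der_hom_unary(1)[OF f] and gr = Der_hom_unary(2)[OF f, simplified]
  obtain D where D: "D \<in> Der_A" and mult: "\<And>d e a x. a \<in> gradeA S d \<Longrightarrow> x \<in> gradeL S e \<Longrightarrow>
      f [act S a x] = act S a (f [x]) + act S (D a) x"
    using Der_hom_unary(3)[OF f] by auto
  then obtain \<tau> D1 where \<tau>: "\<tau> \<in> superder_A 0" and D1: "D1 \<in> superder_A 1"
    and D_eq: "D = (\<lambda>a. \<tau> a + D1 a)"
    unfolding Der_alg_def by blast
  have "f [act S a x] = act S a (f [x]) + act S (\<tau> a) x"
    if a: "a \<in> gradeA S d" and x: "x \<in> gradeL S e" for a d x e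
  proof -
    have \<tau>a: "\<tau> a \<in> gradeA S d" and D1a: "D1 a \<in> gradeA S (d + 1)"
      using \<tau> D1 a by (auto simp: superderivations_def)
    have eq: "act S (D1 a) x = f [act S a x] - act S a (f [x]) - act S (\<tau> a) x"
      using mult[OF a x] by (simp add: D_eq act_simps)
    have "act S (D1 a) x \<in> gradeL S (d + e)"
      unfolding eq by (intro L.grade_simps gr act_grade a x \<tau>a)
    moreover have "act S (D1 a) x \<in> gradeL S (d + e + 1)"
      using act_grade[OF D1a x] by (simp add: ac_simps)
    ultimately have "act S (D1 a) x = 0" by (rule L.grade_disjoint)
    with eq show ?thesis by (simp add: algebra_simps)
  qed
  note hom = this
  have "f [act S a x] = act S a (f [x]) + act S (\<tau> a) x" for a x
  proof -
    obtain a0 a1 where a: "a0 \<in> gradeA S 0" "a1 \<in> gradeA S 1" "a = a0 + a1"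
      by (rule A.grade_decomp)
    obtain x0 x1 where x: "x0 \<in> gradeL S 0" "x1 \<in> gradeL S 1" "x = x0 + x1"
      by (rule L.grade_decomp)
    have "\<tau> (a0 + a1) = \<tau> a0 + \<tau> a1" using \<tau> by (auto simp: superderivations_def lin_A_iff)
    then show ?thesis
      unfolding a(3) x(3)
      by (simp add: act_simps V.lin_simps[OF lin] hom[OF a(1) x(1)] hom[OF a(1) x(2)]
          hom[OF a(2) x(1)] hom[OF a(2) x(2)] algebra_simps)
  qed
  then show ?thesis
    using \<tau> lin gr unfolding even_module_derivation_def by blast
qed

lemma even_module_derivation_minus:
  assumes "even_module_derivation \<phi> \<tau>"
  shows "even_module_derivation (\<lambda>x. - \<phi> x) (\<lambda>a. - \<tau> a)"
proof -
  have "(\<lambda>a. scaleA S (- 1) (\<tau> a)) \<in> superder_A 0"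
    using assms by (intro superder_scale) (simp add: even_module_derivation_def)
  then have "(\<lambda>a. - \<tau> a) \<in> superder_A 0" by simp
  with assms show ?thesis
    by (auto simp: even_module_derivation_def V.lin_iff act_simps L.grade_simps)
qed

text \<open>Split the primitive as \<open>f0 + f1\<close>. Both \<open>c\<close> and the coboundary
  of \<open>f0\<close> are even, so the coboundary of the odd \<open>f1\<close> is at once even and
  odd, hence zero, and \<open>f0\<close> alone is a primitive.\<close>

lemma two_coboundary_even:
  assumes c: "c \<in> Der_hom S 0 1" and cob: "two_coboundary S c"
  obtains \<phi> \<tau> where "even_module_derivation \<phi> \<tau>"
    and "\<And>x y. c [x, y] = derive_bilinear \<phi> (bracketL S) x y"
proof -
  obtain f0 f1 where f0: "f0 \<in> Der_hom S 0 0" and f1: "f1 \<in> Der_hom S 1 0"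
    and c_eq: "c = differential S 1 (\<lambda>xs. f0 xs + f1 xs)"
    using cob unfolding two_coboundary_def C_def_def Der_def by auto
  define \<phi> where "\<phi> x = f0 [x]" for x
  obtain \<tau> where \<phi>: "even_module_derivation \<phi> \<tau>"
    using Der_hom_even_module_derivation[OF f0] unfolding \<phi>_def by blast
  have \<phi>_lin: "V.lin \<phi>" and \<phi>_gr: "\<And>d x. x \<in> gradeL S d \<Longrightarrow> \<phi> x \<in> gradeL S d"
    using \<phi> by (auto simp: even_module_derivation_def)
  have c_Der: "even_Der1 (\<lambda>x y. c [x, y])" by (rule Der_hom_binary_cochain(1)[OF c])
  then have c_bilin: "V.bilin (\<lambda>x y. c [x, y])" unfolding even_Der1_def by blast
  note br = V.bilin_simps[OF bilin_bracket]
  have zero: "f0 [0] + f1 [0] = 0"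
    using V.lin_simps(3)[OF Der_hom_unary(1)[OF f0]] V.lin_simps(3)[OF Der_hom_unary(1)[OF f1]] by simp
  have "c [x, y] = derive_bilinear \<phi> (bracketL S) x y"
    if x: "x \<in> gradeL S d" and y: "y \<in> gradeL S e" for x y d e
  proof -
    let ?R = "bracketL S (f1 [x]) y - psign (d * e) (bracketL S (f1 [y]) x) - f1 [bracketL S x y]"
    \<comment> \<open>Skew symmetry rewrites the transposed term of the differential as the second
      term of \<open>derive_bilinear\<close>; the degree of \<open>\<phi> y\<close> is still
      \<open>e\<close>, so the signs match.\<close>
    have skew: "bracketL S x (\<phi> y) = - psign (d * e) (bracketL S (\<phi> y) x)"
      by (rule L.super_skew[OF x \<phi>_gr[OF y]])
    have R: "c [x, y] - derive_bilinear \<phi> (bracketL S) x y = ?R"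
      unfolding c_eq differential_unary[of "\<lambda>xs. f0 xs + f1 xs", OF zero x y] derive_bilinear_def skew
      by (simp add: \<phi>_def br psign_add algebra_simps)
    have "c [x, y] \<in> gradeL S (d + e)" using c_Der x y unfolding even_Der1_def by blast
    then have "c [x, y] - derive_bilinear \<phi> (bracketL S) x y \<in> gradeL S (d + e)"
      unfolding derive_bilinear_def by (intro L.grade_simps L.br_grade \<phi>_gr x y)
    moreover have "?R \<in> gradeL S (d + e + 1)"
    proof (intro L.grade_simps(3,6))
      note f1_gr = Der_hom_unary(2)[OF f1]
      show "bracketL S (f1 [x]) y \<in> gradeL S (d + e + 1)"
        using L.br_grade[OF f1_gr[OF x] y] by (simp add: ac_simps)
      show "bracketL S (f1 [y]) x \<in> gradeL S (d + e + 1)"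
        using L.br_grade[OF f1_gr[OF y] x] by (simp add: ac_simps)
      show "f1 [bracketL S x y] \<in> gradeL S (d + e + 1)"
        by (rule f1_gr[OF L.br_grade[OF x y]])
    qed
    ultimately have "c [x, y] - derive_bilinear \<phi> (bracketL S) x y = 0"
      unfolding R by (rule L.grade_disjoint)
    then show ?thesis by simp
  qed
  then have "c [x, y] = derive_bilinear \<phi> (bracketL S) x y" for x y
    by (rule bilin_eqI[where B = "\<lambda>x y. c [x, y]", OF c_bilin V.bilin_derive[OF \<phi>_lin bilin_bracket]])
  with \<phi> that show thesis by blast
qed

section \<open>Transport of the Jacobi identity and removal of one coefficient\<close>

lemma biadditive_Der_hom:
  assumes "f \<in> Der_hom S 0 1" shows "biadditive f"
proof -
  have "V.bilin (\<lambda>x y. f [x, y])"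
    using Der_hom_binary_cochain(1)[OF assms] unfolding even_Der1_def by blast
  from V.bilin_simps[OF this] show ?thesis by (simp add: biadditive_def)
qed

text \<open>Applying \<open>\<Phi>\<close> to both sides turns the identity for \<open>M'\<close> at
  \<open>x\<close>, \<open>y\<close>, \<open>z\<close> into the one for \<open>M\<close> at their
  images, series with coefficients of unchanged degree because \<open>\<Phi>\<close> is even.
  Injectivity of \<open>\<Phi>\<close> then gives the claim.\<close>

lemma jacobi_transport:
  assumes M: "deformation S M" and M': "\<And>i. biadditive (M' i)"
    and \<Phi>: "formal_automorphism S \<Phi>"
    and int: "\<And>x y. series_apply \<Phi> (series_apply2 M' (series_const x) (series_const y)) =
      series_apply2 M (series_apply \<Phi> (series_const x)) (series_apply \<Phi> (series_const y))"
    and x: "x \<in> gradeL S d" and y: "y \<in> gradeL S e" and z: "z \<in> gradeL S f"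
  shows "series_apply2 M' (series_const x) (series_apply2 M' (series_const y) (series_const z)) =
    (\<lambda>n. series_apply2 M' (series_apply2 M' (series_const x) (series_const y)) (series_const z) n +
      psign (d * e) (series_apply2 M' (series_const y) (series_apply2 M' (series_const x) (series_const z)) n))"
proof -
  have lin: "V.lin (\<Phi> i)" for i using \<Phi> by (simp add: formal_automorphism_def)
  note lins = V.lin_simps[OF lin]
  have M_add: "biadditive (M i)" for i
    using M by (intro biadditive_Der_hom) (simp add: deformation_def)
  note P = intertwines_series[of \<Phi> M M', OF lins(1) M_add M' int]
  have gr: "series_apply \<Phi> (series_const x) n \<in> gradeL S d" if "x \<in> gradeL S d" for x d n
    using \<Phi> that unfolding series_apply_const[of \<Phi>, OF lins(3)] formal_automorphism_def by blast
  have P_add: "series_apply \<Phi> (\<lambda>n. X n + psign s (Y n)) =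
      (\<lambda>n. series_apply \<Phi> X n + psign s (series_apply \<Phi> Y n))" for X Y s
    by (simp add: fun_eq_iff series_apply_def lins sum.distrib psign_sum)
  let ?X = "series_apply \<Phi> (series_const x)" and ?Y = "series_apply \<Phi> (series_const y)"
    and ?Z = "series_apply \<Phi> (series_const z)"
  have "series_apply2 M ?X (series_apply2 M ?Y ?Z) =
      (\<lambda>n. series_apply2 M (series_apply2 M ?X ?Y) ?Z n +
        psign (d * e) (series_apply2 M ?Y (series_apply2 M ?X ?Z) n))"
  proof (rule jacobi_series[of M "gradeL S d" "gradeL S e" "gradeL S f" "d * e" ?X ?Y ?Z])
    fix x y z assume xyz: "x \<in> gradeL S d" "y \<in> gradeL S e" "z \<in> gradeL S f"
    show "series_apply2 M (series_const x) (series_apply2 M (series_const y) (series_const z)) =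
        (\<lambda>n. series_apply2 M (series_apply2 M (series_const x) (series_const y)) (series_const z) n +
          psign (d * e) (series_apply2 M (series_const y) (series_apply2 M (series_const x) (series_const z)) n))"
      by (rule ext)
        (rule M[unfolded deformation_def Let_def, THEN conjunct2, THEN conjunct2, rule_format, OF xyz])
  qed (rule M_add gr x y z)+
  note jacobi = this
  show ?thesis
  proof (rule series_apply_inj[of \<Phi>])
    show "\<Phi> 0 = id" using \<Phi> unfolding formal_automorphism_def by blast
  qed (simp only: P P_add jacobi)
qed

lemma gauge_step:
  assumes M: "deformation S M" and N: "N \<ge> 1"
    and below: "\<And>j. 1 \<le> j \<Longrightarrow> j < N \<Longrightarrow> M j = (\<lambda>_. 0)" and cob: "two_coboundary S (M N)"
  obtains \<Phi> M' where "formal_automorphism S \<Phi>" "\<And>i. 1 \<le> i \<Longrightarrow> i < N \<Longrightarrow> \<Phi> i = (\<lambda>_. 0)"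
    "deformation S M'" "\<And>j. 1 \<le> j \<Longrightarrow> j \<le> N \<Longrightarrow> M' j = (\<lambda>_. 0)"
    "\<And>x y. series_apply \<Phi> (series_apply2 M' (series_const x) (series_const y)) =
      series_apply2 M (series_apply \<Phi> (series_const x)) (series_apply \<Phi> (series_const y))"
proof -
  have M0: "M 0 = m_cochain S" and MD: "\<And>i. M i \<in> Der_hom S 0 1"
    using M by (auto simp: deformation_def)
  obtain \<psi> \<sigma> where \<psi>: "even_module_derivation \<psi> \<sigma>"
    and MN: "\<And>x y. M N [x, y] = derive_bilinear \<psi> (bracketL S) x y"
    using two_coboundary_even[OF MD cob] by blast
  \<comment> \<open>The sign is forced: conjugation adds
    \<open>derive_bilinear \<phi> (bracketL S)\<close> in degree \<open>N\<close>, where the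
    coefficient to be removed is \<open>derive_bilinear \<psi> (bracketL S)\<close>.\<close>
  define \<phi> where "\<phi> x = - \<psi> x" for x
  have \<phi>: "even_module_derivation \<phi> (\<lambda>a. - \<sigma> a)"
    using even_module_derivation_minus[OF \<psi>] by (simp add: \<phi>_def[abs_def])
  have lin: "V.lin \<phi>" and gr: "\<And>d x. x \<in> gradeL S d \<Longrightarrow> \<phi> x \<in> gradeL S d"
    using \<phi> by (auto simp: even_module_derivation_def)
  define B where "B i x y = M i [x, y]" for i x y
  have B: "even_Der1 (B i)" for i
    using Der_hom_binary_cochain(1)[OF MD] by (simp add: B_def[abs_def])
  then have B_bilin: "V.bilin (B i)" for i unfolding even_Der1_def by blast
  have B0: "B 0 = bracketL S" by (simp add: B_def[abs_def] M0 m_cochain_binary)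
  define \<Phi> where "\<Phi> = V.exp_coeff N \<phi>"
  define M' where "M' n = binary_cochain (V.exp_conjugate N \<phi> B n)" for n
  have M'D: "M' i \<in> Der_hom S 0 1" for i
    unfolding M'_def by (intro binary_cochain_Der_hom even_Der1_exp_conjugate[OF \<phi> B])
  have \<Phi>_lin: "V.lin (\<Phi> i)" for i
    unfolding \<Phi>_def by (rule V.lin_exp_coeff[OF lin])
  have gr_pow: "(\<phi> ^^ k) x \<in> gradeL S d" if "x \<in> gradeL S d" for k x d
    using that by (induction k) (auto intro: gr)
  have \<Phi>: "formal_automorphism S \<Phi>"
    unfolding formal_automorphism_def
  proof (intro conjI allI ballI)
    show "\<Phi> 0 = id" by (simp add: fun_eq_iff \<Phi>_def V.exp_coeff_def)
    show "\<Phi> i x \<in> gradeL S d" if "x \<in> gradeL S d" for i x d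
      unfolding \<Phi>_def V.exp_coeff_def V.divpow_def
      using that by (simp add: L.grade_simps gr_pow)
  qed (rule \<Phi>_lin)
  have int: "series_apply \<Phi> (series_apply2 M' (series_const x) (series_const y)) =
      series_apply2 M (series_apply \<Phi> (series_const x)) (series_apply \<Phi> (series_const y))" for x y
  proof
    fix n
    note zero = V.lin_simps(3)[OF \<Phi>_lin]
    have "series_apply2 M' (series_const x) (series_const y) k = M' k [x, y]" for k
    proof -
      have "M' i [series_const x j, series_const y l] = (if j = 0 \<and> l = 0 then M' i [x, y] else 0)" for i j l
        using biadditive_zero[OF biadditive_Der_hom[OF M'D]] by (simp add: series_const_def)
      then have "series_apply2 M' (series_const x) (series_const y) k =
          (\<Sum>i\<le>k. \<Sum>j\<le>k - i. if j = 0 then if i = k then M' k [x, y] else 0 else 0)"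
        unfolding series_apply2_def by (intro sum.cong) auto
      then show ?thesis by simp
    qed
    then have "series_apply \<Phi> (series_apply2 M' (series_const x) (series_const y)) n =
        (\<Sum>i\<le>n. V.exp_coeff N \<phi> i (V.exp_conjugate N \<phi> B (n - i) x y))"
      by (simp add: series_apply_def \<Phi>_def M'_def)
    also have "\<dots> = (\<Sum>i\<le>n. \<Sum>j\<le>n - i. B i (V.exp_coeff N \<phi> j x) (V.exp_coeff N \<phi> (n - i - j) y))"
      by (rule V.exp_conjugate_intertwines[OF lin B_bilin N])
    also have "\<dots> = series_apply2 M (series_apply \<Phi> (series_const x)) (series_apply \<Phi> (series_const y)) n"
      unfolding series_apply2_def series_apply_const[of \<Phi>, OF zero] by (simp add: B_def \<Phi>_def)
    finally show "series_apply \<Phi> (series_apply2 M' (series_const x) (series_const y)) n =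
        series_apply2 M (series_apply \<Phi> (series_const x)) (series_apply \<Phi> (series_const y)) n" .
  qed
  have "deformation S M'"
    unfolding deformation_def Let_def
  proof (intro conjI allI ballI)
    show "M' 0 = m_cochain S"
      using N by (simp add: M'_def V.exp_conjugate_below B0 m_cochain_binary)
    fix d e f x y z n
    assume "x \<in> gradeL S d" "y \<in> gradeL S e" "z \<in> gradeL S f"
    from jacobi_transport[OF M biadditive_Der_hom[OF M'D] \<Phi> int this]
    show "series_apply2 M' (series_const x) (series_apply2 M' (series_const y) (series_const z)) n =
        series_apply2 M' (series_apply2 M' (series_const x) (series_const y)) (series_const z) n +
        psign (d * e) (series_apply2 M' (series_const y) (series_apply2 M' (series_const x) (series_const z)) n)"
      by (rule fun_cong)
  qed (rule M'D)
  moreover have "M' j = (\<lambda>_. 0)" if "1 \<le> j" "j \<le> N" for j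
  proof -
    have "V.exp_conjugate N \<phi> B j x y = 0" for x y
    proof (cases "j = N")
      case True
      have "derive_bilinear \<phi> (bracketL S) x y = - derive_bilinear \<psi> (bracketL S) x y"
        by (simp add: derive_bilinear_def \<phi>_def V.bilin_simps[OF bilin_bracket])
      then show ?thesis
        unfolding True V.exp_conjugate_at[OF N] B0 by (simp add: B_def MN)
    next
      case False
      with that show ?thesis by (simp add: V.exp_conjugate_below B_def below)
    qed
    then show ?thesis by (simp add: M'_def binary_cochain_def fun_eq_iff)
  qed
  moreover have "\<Phi> i = (\<lambda>_. 0)" if "1 \<le> i" "i < N" for i
    using that by (auto simp: \<Phi>_def V.exp_coeff_def fun_eq_iff dest: dvd_imp_le)
  ultimately show thesis using \<Phi> int that by blast
qed

section \<open>Products of equivalences and their limit\<close>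

lemma series_apply_id_coeff:
  "series_apply (\<lambda>i. if i = 0 then id else (\<lambda>_. 0)) X = X"
proof
  fix n
  have "series_apply (\<lambda>i. if i = 0 then id else (\<lambda>_. 0)) X n = (\<Sum>i\<le>n. if i = 0 then X n else 0)"
    unfolding series_apply_def by (rule sum.cong) auto
  then show "series_apply (\<lambda>i. if i = 0 then id else (\<lambda>_. 0)) X n = X n" by simp
qed

lemma formal_automorphism_id: "formal_automorphism S (\<lambda>i. if i = 0 then id else (\<lambda>_. 0))"
  by (auto simp: formal_automorphism_def V.lin_iff L.grade_simps)

lemma formal_automorphism_compose:
  assumes \<Phi>: "formal_automorphism S \<Phi>" and \<Psi>: "formal_automorphism S \<Psi>"
  shows "formal_automorphism S (series_compose \<Phi> \<Psi>)"
proof -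
  have \<Phi>_lin: "V.lin (\<Phi> i)" and \<Psi>_lin: "V.lin (\<Psi> i)" for i
    using \<Phi> \<Psi> by (auto simp: formal_automorphism_def)
  have "V.lin (series_compose \<Phi> \<Psi> i)" for i
    unfolding V.lin_iff series_compose_def series_apply_def
    by (simp add: V.lin_simps[OF \<Phi>_lin] V.lin_simps[OF \<Psi>_lin] sum.distrib L.scale_sum_right)
  moreover have "series_compose \<Phi> \<Psi> i x \<in> gradeL S d" if "x \<in> gradeL S d" for i x d
    unfolding series_compose_def series_apply_def
    using that \<Phi> \<Psi> by (intro L.grade_simps(7)) (simp add: formal_automorphism_def)
  moreover have "series_compose \<Phi> \<Psi> 0 = id"
    using \<Phi> \<Psi> by (simp add: fun_eq_iff series_compose_def series_apply_def formal_automorphism_def)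
  ultimately show ?thesis by (simp add: formal_automorphism_def)
qed

text \<open>Equivalence with the automorphism exposed, since the limit is taken over the
  automorphisms themselves.\<close>

definition equivalent_via ::
  "(nat \<Rightarrow> 'l list \<Rightarrow> 'l) \<Rightarrow> (nat \<Rightarrow> 'l list \<Rightarrow> 'l) \<Rightarrow> (nat \<Rightarrow> 'l \<Rightarrow> 'l) \<Rightarrow> bool"
  where "equivalent_via M M' \<Phi> \<longleftrightarrow> formal_automorphism S \<Phi> \<and>
    (\<forall>x y. series_apply \<Phi> (series_apply2 M' (series_const x) (series_const y)) =
      series_apply2 M (series_apply \<Phi> (series_const x)) (series_apply \<Phi> (series_const y)))"

lemma equivalent_via_compose:
  assumes M: "\<And>i. biadditive (M i)" and M': "\<And>i. biadditive (M' i)"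
    and \<Phi>: "equivalent_via M M' \<Phi>" and \<Psi>: "equivalent_via M' M'' \<Psi>"
  shows "equivalent_via M M'' (series_compose \<Phi> \<Psi>)"
proof -
  have \<Phi>_aut: "formal_automorphism S \<Phi>" and \<Psi>_aut: "formal_automorphism S \<Psi>"
    using \<Phi> \<Psi> unfolding equivalent_via_def by blast+
  have lin: "V.lin (\<Phi> i)" "V.lin (\<Psi> i)" for i
    using \<Phi>_aut \<Psi>_aut by (simp_all add: formal_automorphism_def)
  have \<Phi>_int: "series_apply \<Phi> (series_apply2 M' (series_const x) (series_const y)) =
      series_apply2 M (series_apply \<Phi> (series_const x)) (series_apply \<Phi> (series_const y))" for x y
    using \<Phi> unfolding equivalent_via_def by blast
  have \<Psi>_int: "series_apply \<Psi> (series_apply2 M'' (series_const x) (series_const y)) =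
      series_apply2 M' (series_apply \<Psi> (series_const x)) (series_apply \<Psi> (series_const y))" for x y
    using \<Psi> unfolding equivalent_via_def by blast
  note comp = series_apply_compose[of \<Phi> \<Psi>, OF V.lin_simps(1)[OF lin(1)] V.lin_simps(1)[OF lin(2)]]
  note int = intertwines_series[of \<Phi> M M', OF V.lin_simps(1)[OF lin(1)] M M' \<Phi>_int]
  show ?thesis
    unfolding equivalent_via_def comp \<Psi>_int int
    using formal_automorphism_compose[OF \<Phi>_aut \<Psi>_aut] by blast
qed

text \<open>This is the convergence of the infinite product: a right factor that is the identity
  modulo t^N leaves the coefficients below \<open>N\<close> unchanged.\<close>

lemma series_compose_cong_below:
  assumes "\<And>i. \<Phi> i 0 = 0" "\<Psi> 0 = id" "\<And>i. 1 \<le> i \<Longrightarrow> i < N \<Longrightarrow> \<Psi> i = (\<lambda>_. 0)" "n < N"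
  shows "series_compose \<Phi> \<Psi> n = \<Phi> n"
proof
  fix x
  have "series_compose \<Phi> \<Psi> n x = (\<Sum>i\<le>n. if i = n then \<Phi> n x else 0)"
    unfolding series_compose_def series_apply_def
    by (rule sum.cong) (use assms in auto)
  then show "series_compose \<Phi> \<Psi> n x = \<Phi> n x" by simp
qed

lemma non_trivial_deformation_infinitesimal:
  assumes mt: "deformation S mt" and nontriv: "\<not> trivial_deformation S mt"
  shows "\<exists>mt'. deformation S mt' \<and> equivalent_deformations S mt mt' \<and>
    (\<exists>c. infinitesimal mt' c \<and> \<not> two_coboundary S c)"
proof (rule ccontr)
  assume contra: "\<not> ?thesis"
  have cob: "two_coboundary S c"
    if "deformation S M" "equivalent_via mt M \<Phi>" "infinitesimal M c" for M \<Phi> c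
    using contra that unfolding equivalent_via_def equivalent_deformations_def by blast
  have biadd: "biadditive (M i)" if "deformation S M" for M i
    using that by (intro biadditive_Der_hom) (simp add: deformation_def)
  \<comment> \<open>The state at stage \<open>N\<close> pairs the accumulated automorphism with the
    deformation reached. Equivalence is kept relative to the original \<open>mt\<close>, because the
    assumption being refuted speaks only of deformations equivalent to \<open>mt\<close>.\<close>
  define P where "P N p \<longleftrightarrow> deformation S (snd p) \<and> equivalent_via mt (snd p) (fst p) \<and>
    (\<forall>j. 1 \<le> j \<longrightarrow> j \<le> N \<longrightarrow> snd p j = (\<lambda>_. 0))" for N :: nat and p
  have "\<exists>p. \<forall>N. P N (p N) \<and> (\<forall>i\<le>N. fst (p (Suc N)) i = fst (p N) i)"
  proof (rule dependent_nat_choice)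
    have "P 0 (\<lambda>i. if i = 0 then id else (\<lambda>_. 0), mt)"
      using mt by (simp add: P_def equivalent_via_def formal_automorphism_id series_apply_id_coeff)
    then show "\<exists>p. P 0 p" by blast
  next
    fix p N assume "P N p"
    obtain \<Phi> M where p: "p = (\<Phi>, M)" by (cases p)
    have M: "deformation S M" and \<Phi>: "equivalent_via mt M \<Phi>"
      and M_zero: "\<And>j. 1 \<le> j \<Longrightarrow> j \<le> N \<Longrightarrow> M j = (\<lambda>_. 0)"
      using \<open>P N p\<close> by (auto simp: P_def p)
    show "\<exists>q. P (Suc N) q \<and> (\<forall>i\<le>N. fst q i = fst p i)"
    \<comment> \<open>If the next coefficient already vanishes, the state is kept. Otherwise it is
      the first non-zero one, hence the infinitesimal, and a gauge step removes it.\<close>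
    proof (cases "M (Suc N) = (\<lambda>_. 0)")
      case True
      then have "P (Suc N) p"
        using M \<Phi> M_zero by (auto simp: P_def p le_Suc_eq)
      then show ?thesis by blast
    next
      case False
      then have "infinitesimal M (M (Suc N))"
        unfolding infinitesimal_def using M_zero by (intro exI[of _ "Suc N"]) auto
      then have "two_coboundary S (M (Suc N))" by (rule cob[OF M \<Phi>])
      then obtain \<Psi> M' where \<Psi>: "formal_automorphism S \<Psi>"
        and \<Psi>_zero: "\<And>i. 1 \<le> i \<Longrightarrow> i < Suc N \<Longrightarrow> \<Psi> i = (\<lambda>_. 0)"
        and M': "deformation S M'" and M'_zero: "\<And>j. 1 \<le> j \<Longrightarrow> j \<le> Suc N \<Longrightarrow> M' j = (\<lambda>_. 0)"
        and int: "\<And>x y. series_apply \<Psi> (series_apply2 M' (series_const x) (series_const y)) =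
          series_apply2 M (series_apply \<Psi> (series_const x)) (series_apply \<Psi> (series_const y))"
        using gauge_step[OF M, of "Suc N"] M_zero by (metis le_add1 plus_1_eq_Suc less_Suc_eq_le)
      have "equivalent_via M M' \<Psi>"
        using \<Psi> int by (simp add: equivalent_via_def)
      then have "equivalent_via mt M' (series_compose \<Phi> \<Psi>)"
        by (rule equivalent_via_compose[OF biadd[OF mt] biadd[OF M] \<Phi>])
      then have "P (Suc N) (series_compose \<Phi> \<Psi>, M')"
        using M' M'_zero by (simp add: P_def)
      moreover have "series_compose \<Phi> \<Psi> i = \<Phi> i" if "i \<le> N" for i
      proof (rule series_compose_cong_below[where N = "Suc N"])
        have "V.lin (\<Phi> i)" for i
          using \<Phi> by (simp add: equivalent_via_def formal_automorphism_def)
        then show "\<Phi> i 0 = 0" for i by (rule V.lin_simps(3))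
        show "\<Psi> 0 = id" using \<Psi> by (simp add: formal_automorphism_def)
      qed (use \<Psi>_zero that in auto)
      ultimately show ?thesis by (intro exI[of _ "(series_compose \<Phi> \<Psi>, M')"]) (simp add: p)
    qed
  qed
  then obtain p where P: "\<And>N. P N (p N)" and stable: "\<And>N i. i \<le> N \<Longrightarrow> fst (p (Suc N)) i = fst (p N) i"
    by blast
  \<comment> \<open>Diagonal choice: coefficient \<open>i\<close> no longer changes from stage
    \<open>i\<close> on.\<close>
  define \<Phi> where "\<Phi> i = fst (p i) i" for i
  have \<Phi>_eq: "fst (p N) i = \<Phi> i" if "i \<le> N" for N i
    using that by (induction N rule: dec_induct) (auto simp: \<Phi>_def stable)
  have aut: "formal_automorphism S (fst (p N))" for N
    using P[of N] by (simp add: P_def equivalent_via_def)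
  have "formal_automorphism S \<Phi>"
    using aut unfolding formal_automorphism_def \<Phi>_def by simp
  moreover have "series_apply \<Phi> (series_apply2 (constant_deformation S) (series_const x) (series_const y)) =
      series_apply2 mt (series_apply \<Phi> (series_const x)) (series_apply \<Phi> (series_const y))" for x y
  proof
    fix n
    \<comment> \<open>The intertwining equation in degree \<open>n\<close> involves only
      coefficients of index at most \<open>n\<close>, and there stage \<open>n\<close> agrees with
      the limit automorphism and with the constant deformation.\<close>
    have M_eq: "snd (p n) i = constant_deformation S i" if "i \<le> n" for i
      using P[of n] that by (cases "i = 0") (auto simp: P_def deformation_def constant_deformation_def)
    have apply_eq: "series_apply \<Phi> X k = series_apply (fst (p n)) X k" if "k \<le> n" for X k
      unfolding series_apply_def using that by (intro sum.cong) (auto simp: \<Phi>_eq)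
    have apply2_eq: "series_apply2 (constant_deformation S) X Y k = series_apply2 (snd (p n)) X Y k"
      if "k \<le> n" for X Y k
      unfolding series_apply2_def using that by (intro sum.cong) (auto simp: M_eq)
    have "series_apply \<Phi> (series_apply2 (constant_deformation S) (series_const x) (series_const y)) n =
        series_apply (fst (p n)) (series_apply2 (constant_deformation S) (series_const x) (series_const y)) n"
      by (simp add: apply_eq)
    also have "\<dots> = series_apply (fst (p n)) (series_apply2 (snd (p n)) (series_const x) (series_const y)) n"
      unfolding series_apply_def by (intro sum.cong) (auto simp: apply2_eq)
    also have "\<dots> = series_apply2 mt (series_apply (fst (p n)) (series_const x)) (series_apply (fst (p n)) (series_const y)) n"
      using P[of n] by (simp add: P_def equivalent_via_def)
    also have "\<dots> = series_apply2 mt (series_apply \<Phi> (series_const x)) (series_apply \<Phi> (series_const y)) n"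
      unfolding series_apply2_def by (intro sum.cong) (auto simp: apply_eq)
    finally show "series_apply \<Phi> (series_apply2 (constant_deformation S) (series_const x) (series_const y)) n =
        series_apply2 mt (series_apply \<Phi> (series_const x)) (series_apply \<Phi> (series_const y)) n" .
  qed
  ultimately have "trivial_deformation S mt"
    unfolding trivial_deformation_def equivalent_deformations_def by blast
  with nontriv show False by blast
qed

end

theorem theorem4p16:
  fixes S :: "('k::field_char_0, 'a::ring, 'l::ab_group_add) lie_rinehart"
    and mt :: "nat \<Rightarrow> 'l list \<Rightarrow> 'l"
  assumes "lie_rinehart_superalgebra S"
    and "deformation S mt"
    and "\<not> trivial_deformation S mt"
  shows "\<exists>mt'. deformation S mt' \<and> equivalent_deformations S mt mt' \<and>
    (\<exists>c. infinitesimal mt' c \<and> \<not> two_coboundary S c)"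
proof -
  interpret lie_rinehart_superalgebra S by fact
  interpret lie_rinehart_superalgebra_char_0 S ..
  show ?thesis
    using non_trivial_deformation_infinitesimal assms(2,3) by blast
qed

end
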